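(* Let $G=(V,E)$ be a finite connected Eulerian directed multigraph, let $\alpha$ be a probability distribution on $V$ with $\alpha_i>0$ for all $i\in V$, and let $z\in V$. For an initial sandpile $s_0:V\to\mathbb{Z}$ let $(s_k)_{k\ge0}$ be the closed chain started at $s_0$ and driven by the i.i.d. sequence $i_1,i_2,\ldots$ with law $\alpha$, let $\rho_k=R_z(s_k)$, and let $\tau=\min\{k\ge0: s_k\text{ is not stabilizable}\}$. For $b=0,1,2,\ldots$ put $$p_b:=\sum_{i\in V}\sum_{\eta\in\mathrm{Rec}(z)}\frac{\alpha_i}{\kappa}\mathbf{1}\{\mathrm{av}_{i\to z}(\eta)=b\},\qquad q_b=q_b(s_0):=\mathbb{P}_{s_0}\{\mathrm{av}_{i_\tau\to z}(\rho_\tau)=b\}.$$ Then for each $b$, $q_b(s_0)\to b\,p_b$ as $|s_0|\to-\infty$.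
   Context: Graph and Laplacian. $G=(V,E)$ is a finite directed graph, multiple edges permitted, connected and Eulerian: each vertex $i$ has the same number $\deg(i)$ of incoming edges as outgoing edges. For $u:V\to\mathbb{Z}$, $\Delta u(i)=-\deg(i)u(i)+\sum_e u(e^-)$, the sum being over edges $e$ coming into $i$, with $e^-$ the other endpoint (tail) of $e$. $\delta_i(j)=\mathbf{1}\{i=j\}$. Sandpiles. A sandpile is a function $s:V\to\mathbb{Z}$ (negative values allowed); $|s|=\sum_{i\in V}s(i)$. Vertex $i$ is unstable if $s(i)\ge\deg(i)$; toppling an unstable vertex $i$ replaces $s$ by $s+\Delta\delta_i$. $s$ is stabilizable if some finite (possibly empty) sequence of topplings of unstable vertices leads to a sandpile $\mathcal{S}(s)\le\deg-1$ (coordinatewise); $\mathcal{S}(s)$ does not depend on the sequence chosen. Closed chain. For $i\in V$, $a_i s=\mathcal{S}(s+\delta_i)$ if $s+\delta_i$ is stabilizable, and $a_i s=s+\delta_i$ otherwise. Let $i_1,i_2,\ldots$ be independent random vertices with law $\alpha$. The closed chain started from a sandpile $s_0$ is $s_k=a_{i_k}s_{k-1}$ for $k\ge1$. $\mathbb{P}_{s_0}$ is the law of the process with initial state $s_0$. Sink and recurrent sandpiles. For a vertex $z$ (the sink), $\mathcal{S}_z$ denotes stabilization in which $z$ is forbidden to topple: unstable vertices other than $z$ are toppled until no vertex of $V-\{z\}$ is unstable (this always terminates), and chips entering $z$ disappear. A sandpile $\rho$ is $z$-recurrent if $\rho(z)=\deg(z)$, $\rho(i)\le\deg(i)-1$ for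 all $i\ne z$, and every vertex of $V-\{z\}$ topples exactly once during the stabilization of $\rho+\Delta\delta_z$ with respect to $\mathcal{S}_z$. $\mathrm{Rec}(z)$ is the set of $z$-recurrent sandpiles; its cardinality $\kappa$ does not depend on $z$. Open addition operators. $\hat a_i\rho=\mathcal{S}_z(\rho+\delta_i)$, where the value at $z$ is kept equal to $\deg(z)$ (chips reaching $z$ are discarded; in particular $\hat a_z\rho=\rho$). Each $\hat a_i$ acts as a permutation of $\mathrm{Rec}(z)$, and $\hat a_i^{-1}$ denotes the inverse of this permutation. Burst size. For $\rho\in\mathrm{Rec}(z)$ and $i\in V$, $\mathrm{av}_{i\to z}(\rho):=|\hat a_i^{-1}\rho|-|\rho|+1$. Recurrent representative. Every sandpile $s$ can be written in exactly one way as $s=\rho+m\delta_z+\Delta v$ with $\rho\in\mathrm{Rec}(z)$, $m\in\mathbb{Z}$, $v:V\to\mathbb{Z}$ and $v(z)=0$; $R_z(s)$ denotes this $\rho$. Limit. "$F(s_0)\to L$ as $|s_0|\to-\infty$" means: for every $\epsilon>0$ there is $K<0$ such that $|F(s_0)-L|\le\epsilon$ for every $s_0:V\to\mathbb{Z}$ with $|s_0|<K$. *)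

theory Defs
  imports
    "HOL-Probability.Probability"
    "HOL-Library.Extended_Nat"
    "Graph_Theory.Digraph_Component"
begin

text \<open>
  The vertex set is the whole of a finite type, so that sandpiles and other integer functions on
  the vertices are total functions without junk values. Parallel arcs and loops are permitted.
  The library constant \<open>Digraph_Component.connected\<close> asks for connectedness of the
  underlying undirected graph.
\<close>

definition eulerian_digraph :: "('v::finite, 'e) pre_digraph \<Rightarrow> bool" where
  "eulerian_digraph G \<longleftrightarrow>
     fin_digraph G \<and> verts G = UNIV \<and> Digraph_Component.connected G \<and>
     (\<forall>i. in_degree G i = out_degree G i)"

type_synonym 'v sandpile = "'v \<Rightarrow> int"

definition vdeg :: "('v, 'e) pre_digraph \<Rightarrow> 'v \<Rightarrow> int" where
  "vdeg G i = int (out_degree G i)"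

definition laplacian :: "('v, 'e) pre_digraph \<Rightarrow> ('v \<Rightarrow> int) \<Rightarrow> 'v \<Rightarrow> int" where
  "laplacian G u i = - vdeg G i * u i + (\<Sum>e\<in>in_arcs G i. u (tail G e))"

definition delta :: "'v \<Rightarrow> 'v \<Rightarrow> int" where
  "delta i j = (if i = j then 1 else 0)"

definition chips :: "('v::finite) sandpile \<Rightarrow> int" where
  "chips s = (\<Sum>i\<in>UNIV. s i)"

definition add_chip :: "'v sandpile \<Rightarrow> 'v \<Rightarrow> 'v sandpile" where
  "add_chip s i = (\<lambda>j. s j + delta i j)"

text \<open>
  Toppling is parametrised by a set \<open>Z\<close> of sinks: sinks never topple, and chips
  entering a sink disappear. The closed system has \<open>Z = {}\<close>, the system with sink
  \<open>z\<close> has \<open>Z = {z}\<close>.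
\<close>

definition topple :: "('v, 'e) pre_digraph \<Rightarrow> 'v set \<Rightarrow> 'v \<Rightarrow> 'v sandpile \<Rightarrow> 'v sandpile" where
  "topple G Z i s = (\<lambda>j. if j \<in> Z then s j else s j + laplacian G (delta i) j)"

inductive topplings ::
    "('v, 'e) pre_digraph \<Rightarrow> 'v set \<Rightarrow> 'v sandpile \<Rightarrow> 'v list \<Rightarrow> 'v sandpile \<Rightarrow> bool"
  for G Z where
  Nil: "topplings G Z s [] s"
| Cons: "i \<notin> Z \<Longrightarrow> s i \<ge> vdeg G i \<Longrightarrow> topplings G Z (topple G Z i s) is t
           \<Longrightarrow> topplings G Z s (i # is) t"

definition stable :: "('v, 'e) pre_digraph \<Rightarrow> 'v set \<Rightarrow> 'v sandpile \<Rightarrow> bool" where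
  "stable G Z s \<longleftrightarrow> (\<forall>i. i \<notin> Z \<longrightarrow> s i \<le> vdeg G i - 1)"

definition stabilizable :: "('v, 'e) pre_digraph \<Rightarrow> 'v set \<Rightarrow> 'v sandpile \<Rightarrow> bool" where
  "stabilizable G Z s \<longleftrightarrow> (\<exists>is t. topplings G Z s is t \<and> stable G Z t)"

definition stabilization :: "('v, 'e) pre_digraph \<Rightarrow> 'v set \<Rightarrow> 'v sandpile \<Rightarrow> 'v sandpile" where
  "stabilization G Z s = (THE t. \<exists>is. topplings G Z s is t \<and> stable G Z t)"

definition closed_add :: "('v, 'e) pre_digraph \<Rightarrow> 'v \<Rightarrow> 'v sandpile \<Rightarrow> 'v sandpile" where
  "closed_add G i s =
     (if stabilizable G {} (add_chip s i) then stabilization G {} (add_chip s i)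
      else add_chip s i)"

text \<open>The driving sequence \<open>x\<close> is indexed from 1; \<open>x 0\<close> is never used.\<close>

primrec closed_chain ::
    "('v, 'e) pre_digraph \<Rightarrow> (nat \<Rightarrow> 'v) \<Rightarrow> 'v sandpile \<Rightarrow> nat \<Rightarrow> 'v sandpile" where
  "closed_chain G x s0 0 = s0"
| "closed_chain G x s0 (Suc k) = closed_add G (x (Suc k)) (closed_chain G x s0 k)"

definition threshold_time ::
    "('v, 'e) pre_digraph \<Rightarrow> (nat \<Rightarrow> 'v) \<Rightarrow> 'v sandpile \<Rightarrow> enat" where
  "threshold_time G x s0 = (INF k \<in> {k. \<not> stabilizable G {} (closed_chain G x s0 k)}. enat k)"

definition recurrent :: "('v, 'e) pre_digraph \<Rightarrow> 'v \<Rightarrow> 'v sandpile \<Rightarrow> bool" where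
  "recurrent G z \<rho> \<longleftrightarrow>
     \<rho> z = vdeg G z \<and> (\<forall>i. i \<noteq> z \<longrightarrow> \<rho> i \<le> vdeg G i - 1) \<and>
     (\<exists>is t. topplings G {z} (\<lambda>j. \<rho> j + laplacian G (delta z) j) is t \<and> stable G {z} t \<and>
             (\<forall>i. i \<noteq> z \<longrightarrow> count_list is i = 1))"

definition Rec :: "('v, 'e) pre_digraph \<Rightarrow> 'v \<Rightarrow> 'v sandpile set" where
  "Rec G z = {\<rho>. recurrent G z \<rho>}"

text \<open>
  Resetting the value at \<open>z\<close> only matters for \<open>i = z\<close>, since toppling with sink
  \<open>z\<close> already discards the chips that reach \<open>z\<close>.
\<close>

definition open_add :: "('v, 'e) pre_digraph \<Rightarrow> 'v \<Rightarrow> 'v \<Rightarrow> 'v sandpile \<Rightarrow> 'v sandpile" where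
  "open_add G z i \<rho> = (stabilization G {z} (add_chip \<rho> i))(z := vdeg G z)"

definition burst :: "('v::finite, 'e) pre_digraph \<Rightarrow> 'v \<Rightarrow> 'v \<Rightarrow> 'v sandpile \<Rightarrow> int" where
  "burst G z i \<rho> = chips (inv_into (Rec G z) (open_add G z i) \<rho>) - chips \<rho> + 1"

definition rec_rep :: "('v, 'e) pre_digraph \<Rightarrow> 'v \<Rightarrow> 'v sandpile \<Rightarrow> 'v sandpile" where
  "rec_rep G z s =
     (THE \<rho>. \<rho> \<in> Rec G z \<and>
        (\<exists>(m::int) v. v z = 0 \<and> s = (\<lambda>j. \<rho> j + m * delta z j + laplacian G v j)))"

definition burst_prob ::
    "('v::finite, 'e) pre_digraph \<Rightarrow> 'v pmf \<Rightarrow> 'v \<Rightarrow> nat \<Rightarrow> real" where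
  "burst_prob G \<alpha> z b =
     (\<Sum>i\<in>UNIV. \<Sum>\<eta>\<in>Rec G z.
        pmf \<alpha> i / real (card (Rec G z)) * (if burst G z i \<eta> = int b then 1 else 0))"

text \<open>
  The event that the threshold time \<open>\<tau>\<close> equals some \<open>k \<ge> 1\<close> and the burst size at
  time \<open>k\<close> is \<open>b\<close>. If \<open>s0\<close> is not stabilizable, then \<open>\<tau> = 0\<close> and there is no vertex
  \<open>X \<tau>\<close>; the event is then empty.
\<close>

definition threshold_burst_prob ::
    "('v::finite, 'e) pre_digraph \<Rightarrow> 'v \<Rightarrow> 'w measure \<Rightarrow> (nat \<Rightarrow> 'w \<Rightarrow> 'v) \<Rightarrow> nat \<Rightarrow> 'v sandpile \<Rightarrow> real"
  where
  "threshold_burst_prob G z M X b s0 =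
     measure M {\<omega> \<in> space M. \<exists>k\<ge>1.
        threshold_time G (\<lambda>n. X n \<omega>) s0 = enat k \<and>
        burst G z (X k \<omega>) (rec_rep G z (closed_chain G (\<lambda>n. X n \<omega>) s0 k)) = int b}"

end

theory Submission
  imports Defs
begin

text \<open>
  Fix the sink \<open>z\<close>. Modulo the Laplacian a sandpile \<open>s\<close> is determined by its recurrent
  representative \<open>\<rho>\<close> and the integer \<open>m\<close> with \<open>s = \<rho> + m \<delta>\<^sub>z + \<Delta> v\<close>; since
  \<open>\<Delta>\<close> preserves the number of chips, \<open>m = |s| - |\<rho>|\<close>. A sandpile is
  stabilizable exactly when \<open>m < 0\<close> (\<open>stabilizable_iff\<close>). One step of the closed chain adds
  a chip up to a Laplacian, whether or not the result is stabilizable. Hence \<open>\<rho>\<^sub>k\<close> moves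
  by the open addition operators, which permute \<open>Rec(z)\<close>, the number of chips at time \<open>k\<close>
  is \<open>|s\<^sub>0| + k\<close>, and \<open>m\<^sub>k - m\<^sub>k\<^sub>-\<^sub>1\<close> is the burst size at time \<open>k\<close>,
  which is never negative. So \<open>\<tau>\<close> is the time at which \<open>m\<^sub>k\<close> crosses 0.

  A crossing by a burst of size \<open>b\<close> lands at one of the \<open>b\<close> values
  \<open>m\<^sub>\<tau> = j\<close> with \<open>0 \<le> j < b\<close>. This is the source of the size bias. Because
  \<open>m\<^sub>k = |s\<^sub>0| + k - |\<rho>\<^sub>k|\<close>, the values \<open>\<rho>\<^sub>\<tau> = \<eta>\<close> and
  \<open>m\<^sub>\<tau> = j\<close> determine \<open>\<tau>\<close>. The event in question is therefore the disjoint union,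
  over the finitely many triples \<open>(i, \<eta>, j)\<close> with \<open>av\<^sub>i(\<eta>) = b\<close> and
  \<open>j < b\<close>, of the events \<open>i\<^sub>k = i, \<rho>\<^sub>k = \<eta>\<close> at the deterministic time
  \<open>k = |\<eta>| - |s\<^sub>0| + j\<close> (\<open>threshold_burst_iff_crossing\<close>,
  \<open>takes_crossing_unique\<close>).

  As \<open>|s\<^sub>0| \<rightarrow> -\<infinity>\<close> all these times tend to infinity. The walk
  \<open>\<rho>\<^sub>k\<close> is irreducible and can stay put, because adding a chip at the sink is the identity on
  \<open>Rec(z)\<close>; as a walk by permutations it therefore equidistributes on \<open>Rec(z)\<close>, uniformly in
  the starting point (\<open>equidistribution_last\<close>). So each event has probability close to
  \<open>\<alpha>\<^sub>i / \<kappa>\<close>, and summing over the triples gives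
  \<open>b\<close> times \<open>p\<^sub>b\<close>.
  No renewal theorem enters: conservation of chips replaces the random time by fixed ones.
\<close>
section \<open>The Laplacian of an Eulerian digraph\<close>

locale eulerian_sandpile =
  fixes G :: "('v::finite, 'e) pre_digraph"
  assumes eulerian: "eulerian_digraph G"
begin

abbreviation lap :: "('v \<Rightarrow> int) \<Rightarrow> 'v \<Rightarrow> int" where
  "lap \<equiv> laplacian G"

abbreviation deg :: "'v \<Rightarrow> int" where
  "deg \<equiv> vdeg G"

lemma fin_digraph: "fin_digraph G"
  and verts_UNIV: "verts G = UNIV"
  and connected: "Digraph_Component.connected G"
  and in_degree_eq: "in_degree G i = out_degree G i"
  using eulerian by (auto simp: eulerian_digraph_def)

lemma finite_arcs: "finite (arcs G)"
  using fin_digraph by (simp add: fin_digraph_def fin_digraph_axioms_def)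

lemma finite_in_arcs [simp]: "finite (in_arcs G i)"
  using finite_arcs by (auto simp: in_arcs_def)

lemma card_in_arcs: "int (card (in_arcs G i)) = deg i"
  using in_degree_eq[of i] by (simp add: in_degree_def vdeg_def)

lemma laplacian_altdef: "lap u i = (\<Sum>e\<in>in_arcs G i. u (tail G e) - u i)"
  by (simp add: laplacian_def sum_subtractf card_in_arcs)

lemma laplacian_add: "lap (\<lambda>j. u j + v j) i = lap u i + lap v i"
  by (simp add: laplacian_def sum.distrib algebra_simps)

lemma laplacian_diff: "lap (\<lambda>j. u j - v j) i = lap u i - lap v i"
  by (simp add: laplacian_def sum_subtractf algebra_simps)

lemma laplacian_mult: "lap (\<lambda>j. c * u j) i = c * lap u i"
  by (simp add: laplacian_def sum_distrib_left algebra_simps)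

lemma laplacian_uminus: "lap (\<lambda>j. - u j) i = - lap u i"
  by (simp add: laplacian_def sum_negf algebra_simps)

lemma laplacian_const: "lap (\<lambda>j. c) i = 0"
  by (simp add: laplacian_altdef)

lemma laplacian_at_min: "(\<And>j. u i \<le> u j) \<Longrightarrow> 0 \<le> lap u i"
  by (simp add: laplacian_altdef sum_nonneg)

lemma laplacian_mono: "u i = v i \<Longrightarrow> (\<And>j. u j \<le> v j) \<Longrightarrow> lap u i \<le> lap v i"
  by (auto simp: laplacian_altdef intro: sum_mono)

lemma sum_arcs_by_head: "(\<Sum>i\<in>UNIV. \<Sum>e\<in>in_arcs G i. f e) = (\<Sum>e\<in>arcs G. f e)"
proof -
  have "arcs G = (\<Union>i\<in>UNIV. in_arcs G i)" by (auto simp: in_arcs_def)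
  then show ?thesis
    by (simp only:) (subst sum.UNION_disjoint, auto simp: in_arcs_def finite_arcs)
qed

lemma sum_arcs_by_tail: "(\<Sum>i\<in>UNIV. \<Sum>e\<in>out_arcs G i. f e) = (\<Sum>e\<in>arcs G. f e)"
proof -
  have "arcs G = (\<Union>i\<in>UNIV. out_arcs G i)" by (auto simp: out_arcs_def)
  then show ?thesis
    by (simp only:) (subst sum.UNION_disjoint, auto simp: out_arcs_def finite_arcs)
qed

lemma chips_laplacian: "chips (lap u) = 0"
proof -
  have "(\<Sum>i\<in>UNIV. \<Sum>e\<in>in_arcs G i. u (tail G e)) = (\<Sum>i\<in>UNIV. \<Sum>e\<in>out_arcs G i. u (tail G e))"
    by (simp only: sum_arcs_by_head sum_arcs_by_tail)
  also have "\<dots> = (\<Sum>i\<in>UNIV. deg i * u i)"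
  proof (intro sum.cong refl)
    fix i
    have "(\<Sum>e\<in>out_arcs G i. u (tail G e)) = (\<Sum>e\<in>out_arcs G i. u i)"
      by (intro sum.cong) auto
    then show "(\<Sum>e\<in>out_arcs G i. u (tail G e)) = deg i * u i"
      by (simp add: vdeg_def out_degree_def)
  qed
  finally show ?thesis
    by (simp add: chips_def laplacian_def sum_subtractf sum.distrib sum_negf)
qed

text \<open>
  The Eulerian condition makes a connected digraph strongly connected: a set that no arc leaves
  contains the heads of as many arcs as it contains tails, so no arc enters it either.
\<close>

lemma closed_set_eq_UNIV:
  assumes "x \<in> S" and closed: "\<And>e. e \<in> arcs G \<Longrightarrow> tail G e \<in> S \<Longrightarrow> head G e \<in> S"
  shows "S = UNIV"
proof -
  let ?out = "{e \<in> arcs G. tail G e \<in> S}" and ?in = "{e \<in> arcs G. head G e \<in> S}"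
  have "card ?in = (\<Sum>i\<in>S. card (in_arcs G i))"
  proof -
    have "?in = (\<Union>i\<in>S. in_arcs G i)" by (auto simp: in_arcs_def)
    then show ?thesis
      by (simp only:) (subst card_UN_disjoint, auto simp: in_arcs_def finite_arcs)
  qed
  also have "\<dots> = (\<Sum>i\<in>S. card (out_arcs G i))"
    using in_degree_eq by (simp add: in_degree_def out_degree_def)
  also have "\<dots> = card ?out"
  proof -
    have "?out = (\<Union>i\<in>S. out_arcs G i)" by (auto simp: out_arcs_def)
    then show ?thesis
      by (simp only:) (subst card_UN_disjoint, auto simp: out_arcs_def finite_arcs)
  qed
  finally have "?out = ?in"
    using closed finite_arcs by (intro card_subset_eq) auto
  then have rev: "tail G e \<in> S" if "e \<in> arcs G" "head G e \<in> S" for e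
    using that by blast
  have "y \<in> S" for y
  proof -
    have "x \<rightarrow>\<^sup>*\<^bsub>with_proj (mk_symmetric G)\<^esub> y"
      using connected verts_UNIV
      by (auto simp: Digraph_Component.connected_def strongly_connected_def)
    then show ?thesis
      unfolding reachable_def
    proof (induction rule: rtrancl_on_induct)
      case base
      then show ?case using \<open>x \<in> S\<close> by simp
    next
      case (step y w)
      then have "(y, w) \<in> parcs (mk_symmetric G)" by simp
      then show ?case
        using step closed rev by (auto simp: parcs_mk_symmetric arcs_ends_def arc_to_ends_def)
    qed
  qed
  then show ?thesis by auto
qed

text \<open>
  Such a function makes it possible to push all chips into the sink. In terms of the distance
  \<open>d\<close> from \<open>z\<close> it is \<open>h = M^D - M^(D - d)\<close>. Only lower bounds on the distance of an
  in-neighbour are available in a digraph, but \<open>h\<close> flattens out so fast that the drop towards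
  one closer in-neighbour outweighs the possible rises towards all the others.
\<close>

lemma escape_function_exists:
  obtains h :: "'v \<Rightarrow> int"
  where "h z = 0" and "\<And>i. 0 \<le> h i" and "\<And>i. i \<noteq> z \<Longrightarrow> lap h i \<le> - 1"
proof -
  define R where "R = {(tail G e, head G e) | e. e \<in> arcs G}"
  have "{y. \<exists>n. (z, y) \<in> R ^^ n} = UNIV"
  proof (rule closed_set_eq_UNIV)
    show "z \<in> {y. \<exists>n. (z, y) \<in> R ^^ n}"
      by (auto intro: exI[of _ 0])
    fix e assume "e \<in> arcs G" "tail G e \<in> {y. \<exists>n. (z, y) \<in> R ^^ n}"
    then obtain n where "(z, tail G e) \<in> R ^^ n" "(tail G e, head G e) \<in> R"
      by (auto simp: R_def)
    then have "(z, head G e) \<in> R ^^ Suc n" by auto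
    then show "head G e \<in> {y. \<exists>n. (z, y) \<in> R ^^ n}" by blast
  qed
  then have ex: "\<exists>n. (z, y) \<in> R ^^ n" for y by auto
  define d where "d y = (LEAST n. (z, y) \<in> R ^^ n)" for y
  have d: "(z, y) \<in> R ^^ d y" for y
    unfolding d_def using ex by (rule LeastI_ex)
  have d_le: "d y \<le> n" if "(z, y) \<in> R ^^ n" for y n
    unfolding d_def using that by (rule Least_le)
  define D where "D = Max (range d)"
  have dD: "d y \<le> D" for y by (simp add: D_def)
  define M where "M = 2 + Max (range deg)"
  have M: "deg y + 2 \<le> M" for y by (simp add: M_def)
  have deg_nonneg: "0 \<le> deg y" for y by (simp add: vdeg_def)
  have M2: "2 \<le> M" using M[of z] deg_nonneg[of z] by simp
  define h where "h y = M ^ D - M ^ (D - d y)" for y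
  have "d z = 0" using d_le[of z 0] by simp
  show thesis
  proof
    show "h z = 0" by (simp add: h_def \<open>d z = 0\<close>)
    show "0 \<le> h i" for i using M2 by (simp add: h_def power_increasing)
    fix i assume "i \<noteq> z"
    then have "d i \<noteq> 0" using d[of i] by (cases "d i") auto
    then obtain n where n: "d i = Suc n" by (cases "d i") auto
    with d[of i] obtain w where w: "(z, w) \<in> R ^^ n" "(w, i) \<in> R" by auto
    then obtain e0 where e0: "e0 \<in> in_arcs G i" "tail G e0 = w"
      by (auto simp: R_def in_arcs_def)
    let ?p = "M ^ (D - d i)"
    have p: "?p \<ge> 1" using M2 by simp
    have dw: "d w \<le> n" using w d_le by blast
    then have "D - d w \<ge> Suc (D - d i)" using n dD[of i] by linarith
    then have "M ^ (D - d w) \<ge> M ^ Suc (D - d i)" using M2 by (intro power_increasing) auto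
    then have 1: "h (tail G e0) - h i \<le> ?p - M * ?p" by (simp add: h_def e0)
    have 2: "h (tail G e) - h i \<le> ?p" for e using M2 by (simp add: h_def)
    have "lap h i = (h (tail G e0) - h i) + (\<Sum>e\<in>in_arcs G i - {e0}. h (tail G e) - h i)"
      unfolding laplacian_altdef by (rule sum.remove) (use e0 in auto)
    also have "(\<Sum>e\<in>in_arcs G i - {e0}. h (tail G e) - h i) \<le> of_nat (card (in_arcs G i - {e0})) * ?p"
      by (rule sum_bounded_above) (rule 2)
    also have "\<dots> \<le> deg i * ?p"
      using p card_mono[of "in_arcs G i" "in_arcs G i - {e0}"] card_in_arcs[of i]
      by (intro mult_right_mono) auto
    finally have "lap h i \<le> ?p - M * ?p + deg i * ?p" using 1 by linarith
    also have "\<dots> = (1 + deg i - M) * ?p" by (simp add: algebra_simps)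
    also have "\<dots> \<le> (- 1) * ?p" using M[of i] p by (intro mult_right_mono) auto
    also have "\<dots> \<le> -1" using p by simp
    finally show "lap h i \<le> - 1" .
  qed
qed

section \<open>Toppling and the least action principle\<close>

lemma delta_self [simp]: "delta i i = 1"
  by (simp add: delta_def)

lemma delta_other [simp]: "i \<noteq> j \<Longrightarrow> delta i j = 0"
  by (simp add: delta_def)

lemma delta_nonneg: "0 \<le> delta i j"
  by (simp add: delta_def)

lemma toppleD: "topple G Z i s j = (if j \<in> Z then s j else s j + lap (delta i) j)"
  by (simp add: topple_def)

lemma topplings_result:
  assumes "topplings G Z s is t"
  shows "t j = (if j \<in> Z then s j else s j + lap (\<lambda>k. int (count_list is k)) j)"
  using assms
proof (induction rule: topplings.induct)
  case (Nil s)
  then show ?case by (simp add: laplacian_const)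
next
  case (Cons i s "is" t)
  have "(\<lambda>k. int (count_list (i # is) k)) = (\<lambda>k. delta i k + int (count_list is k))"
    by (auto simp: delta_def)
  then show ?case using Cons.IH by (simp add: laplacian_add toppleD)
qed

lemma topplings_sinks:
  assumes "topplings G Z s is t" and "j \<in> Z"
  shows "count_list is j = 0"
  using assms by (induction rule: topplings.induct) auto

text \<open>
  If \<open>v\<close> vanishes at \<open>i\<close> and is nonnegative elsewhere, adding \<open>\<Delta> v\<close> cannot decrease the
  number of chips at \<open>i\<close>.
\<close>

lemma stabilizer_pos_at_unstable:
  assumes "\<And>j. 0 \<le> v j" and "stable G Z (\<lambda>j. s j + lap v j)" and "i \<notin> Z" and "deg i \<le> s i"
  shows "1 \<le> v i"
proof (rule ccontr)
  assume "\<not> 1 \<le> v i"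
  with assms(1)[of i] have "v i = 0" by simp
  then have "0 \<le> lap v i" using assms(1) by (intro laplacian_at_min) simp
  moreover have "s i + lap v i \<le> deg i - 1" using assms(2,3) by (simp add: stable_def)
  ultimately show False using assms(4) by simp
qed

lemma stable_after_topple:
  assumes "stable G Z (\<lambda>j. s j + lap v j)"
  shows "stable G Z (\<lambda>j. topple G Z i s j + lap (\<lambda>j. v j - delta i j) j)"
  using assms by (simp add: stable_def toppleD laplacian_diff)

text \<open>
  If \<open>v\<close> is nonnegative and stabilizing, then so is \<open>v - \<delta>\<^sub>i\<close> once an unstable \<open>i\<close> has
  toppled; this is what the induction carries along.
\<close>

lemma least_action:
  assumes "topplings G Z s is t"
    and "\<And>j. 0 \<le> v j" and "stable G Z (\<lambda>j. s j + lap v j)"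
  shows "int (count_list is j) \<le> v j"
  using assms
proof (induction arbitrary: v j rule: topplings.induct)
  case (Nil s)
  then show ?case by simp
next
  case (Cons i s "is" t)
  have "1 \<le> v i" using stabilizer_pos_at_unstable Cons.prems Cons.hyps by blast
  then have "0 \<le> v k - delta i k" for k
    using Cons.prems(1)[of k] by (cases "k = i") auto
  from Cons.IH[OF this stable_after_topple[OF Cons.prems(2)], of j]
  show ?case by (cases "j = i") auto
qed

text \<open>
  Each legal toppling replaces \<open>v\<close> by a nonnegative stabilizing function of smaller sum, so
  toppling comes to an end.
\<close>

lemma stabilizing_sequence_exists:
  assumes "\<And>j. 0 \<le> v j" and "stable G Z (\<lambda>j. s j + lap v j)"
  shows "\<exists>is t. topplings G Z s is t \<and> stable G Z t"
  using assms
proof (induction "nat (\<Sum>j\<in>UNIV. v j)" arbitrary: v s rule: less_induct)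
  case less
  show ?case
  proof (cases "stable G Z s")
    case True
    then show ?thesis by (blast intro: topplings.Nil)
  next
    case False
    then obtain i where i: "i \<notin> Z" "deg i \<le> s i" by (auto simp: stable_def not_le)
    have "1 \<le> v i" using stabilizer_pos_at_unstable less.prems i by blast
    then have nonneg: "0 \<le> v k - delta i k" for k
      using less.prems(1)[of k] by (cases "k = i") auto
    have "(\<Sum>j\<in>UNIV. v j - delta i j) = (\<Sum>j\<in>UNIV. v j) - 1"
      by (simp add: sum_subtractf delta_def)
    moreover have "1 \<le> (\<Sum>j\<in>UNIV. v j)"
      using \<open>1 \<le> v i\<close> member_le_sum[of i UNIV v] less.prems(1) by simp
    ultimately have "nat (\<Sum>j\<in>UNIV. v j - delta i j) < nat (\<Sum>j\<in>UNIV. v j)" by simp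
    from less.hyps[OF this nonneg stable_after_topple[OF less.prems(2)]]
    obtain "is" t where "topplings G Z (topple G Z i s) is t" "stable G Z t" by blast
    then show ?thesis using i by (blast intro: topplings.Cons)
  qed
qed

text \<open>
  Each of two stabilizing sequences bounds the other by the least action principle, so both
  topple every vertex equally often.
\<close>

lemma stabilization_unique:
  assumes "topplings G Z s is t" "stable G Z t" "topplings G Z s is' t'" "stable G Z t'"
  shows "t = t'"
proof -
  have le: "count_list is1 j \<le> count_list is2 j"
    if "topplings G Z s is1 t1" "topplings G Z s is2 t2" "stable G Z t2" for is1 is2 t1 t2 j
  proof -
    have "stable G Z (\<lambda>j. s j + lap (\<lambda>k. int (count_list is2 k)) j)"
      using topplings_result[OF that(2)] that(3) by (simp add: stable_def)
    from least_action[OF that(1) _ this, of j] show ?thesis by simp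
  qed
  have "count_list is = count_list is'"
    using le assms by (intro ext antisym) blast+
  then show ?thesis
    using topplings_result[OF assms(1)] topplings_result[OF assms(3)] by auto
qed

lemma stabilization_eqI:
  assumes "topplings G Z s is t" "stable G Z t"
  shows "stabilization G Z s = t"
  unfolding stabilization_def using assms stabilization_unique by (intro the_equality) blast+

definition stable_off :: "'v \<Rightarrow> 'v sandpile \<Rightarrow> bool" where
  "stable_off z s \<longleftrightarrow> (\<forall>i. i \<noteq> z \<longrightarrow> s i \<le> deg i - 1)"

lemma stable_singleton: "stable G {z} s \<longleftrightarrow> stable_off z s"
  by (auto simp: stable_def stable_off_def)

section \<open>Recurrent sandpiles as minimal representatives\<close>

text \<open>
  The burning test amounts to an extremality property of \<open>\<rho>\<close> within its class modulo
  \<open>\<Delta>\<close> and \<open>\<delta>\<^sub>z\<close>, which gives existence and uniqueness of the representative.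

  Stability is meant off \<open>z\<close>, and \<open>v(z) = 0\<close>. If \<open>\<rho>\<close> burns and
  \<open>\<rho> + \<Delta> v\<close> is stable for a \<open>v\<close> whose minimum \<open>m\<close> is negative, then \<open>min (v - m) 1 - \<delta>\<^sub>z\<close> stabilizes \<open>\<rho> + \<Delta> \<delta>\<^sub>z\<close> without toppling the
  vertices where \<open>v = m\<close>, contrary to the least action principle. Conversely, let
  \<open>\<rho>\<close> be minimal. If the stabilization of \<open>\<rho> + \<Delta> \<delta>\<^sub>z\<close> topples according to \<open>u\<close>, then
  \<open>u \<le> 1 - \<delta>\<^sub>z\<close>, and \<open>v = u + \<delta>\<^sub>z - 1 \<le> 0\<close> has \<open>\<rho> + \<Delta> v\<close> stable, so
  minimality gives \<open>v = 0\<close>.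
\<close>

lemma recurrent_iff_minimal:
  "recurrent G z \<rho> \<longleftrightarrow> \<rho> z = deg z \<and> stable_off z \<rho> \<and>
     (\<forall>v. v z = 0 \<longrightarrow> stable_off z (\<lambda>j. \<rho> j + lap v j) \<longrightarrow> (\<forall>j. 0 \<le> v j))"
  (is "_ \<longleftrightarrow> _ \<and> _ \<and> ?min")
proof -
  let ?\<beta> = "\<lambda>j. \<rho> j + lap (delta z) j"
  let ?u = "\<lambda>is j. int (count_list is j)"
  have burn_iff: "(\<exists>is t. topplings G {z} ?\<beta> is t \<and> stable G {z} t \<and> (\<forall>i. i \<noteq> z \<longrightarrow> count_list is i = 1))
        \<longleftrightarrow> ?min" (is "?burn \<longleftrightarrow> _")
    if stab: "stable_off z \<rho>"
  proof
    assume ?burn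
    then obtain "is" t where burn: "topplings G {z} ?\<beta> is t" "\<And>i. i \<noteq> z \<Longrightarrow> count_list is i = 1"
      by blast
    show ?min
    proof (intro allI impI)
      fix v j assume v: "v z = 0" "stable_off z (\<lambda>j. \<rho> j + lap v j)"
      define m where "m = Min (range v)"
      have m_le: "m \<le> v k" for k by (simp add: m_def)
      have "m \<in> range v" unfolding m_def by (intro Min_in) auto
      \<comment> \<open>If \<open>m < 0 = v z\<close>, the first term is 1 at \<open>z\<close> because values are integers; so \<open>w z = 0\<close>.\<close>
      define w where "w k = min (v k - m) 1 - delta z k" for k
      show "0 \<le> v j"
      proof (rule ccontr)
        assume "\<not> 0 \<le> v j"
        then have "m < 0" using m_le[of j] by simp
        have w_nonneg: "0 \<le> w k" for k
          using m_le[of k] \<open>m < 0\<close> v(1) by (cases "k = z") (auto simp: w_def)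
        have "stable G {z} (\<lambda>k. ?\<beta> k + lap w k)"
          unfolding stable_singleton stable_off_def
        proof (intro allI impI)
          fix k assume "k \<noteq> z"
          have w_eq: "lap w k = lap (\<lambda>k. min (v k - m) 1) k - lap (delta z) k"
            unfolding w_def by (rule laplacian_diff)
          show "?\<beta> k + lap w k \<le> deg k - 1"
          proof (cases "v k = m")
            case True
            have "lap (\<lambda>k. min (v k - m) 1) k \<le> lap (\<lambda>k. v k - m) k"
              using True by (intro laplacian_mono) auto
            also have "\<dots> = lap v k" by (simp add: laplacian_diff laplacian_const)
            finally show ?thesis using w_eq v(2) \<open>k \<noteq> z\<close> by (force simp: stable_off_def)
          next
            case False
            then have "v k - m \<ge> 1" using m_le[of k] by simp
            then have "lap (\<lambda>k. min (v k - m) 1) k \<le> lap (\<lambda>k. 1) k"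
              by (intro laplacian_mono) auto
            also have "\<dots> = 0" by (simp add: laplacian_const)
            finally show ?thesis using w_eq stab \<open>k \<noteq> z\<close> by (force simp: stable_off_def)
          qed
        qed
        from least_action[OF burn(1) w_nonneg this]
        have le: "?u is k \<le> w k" for k .
        obtain k where "v k = m" using \<open>m \<in> range v\<close> by auto
        then have "k \<noteq> z" using \<open>m < 0\<close> v(1) by auto
        then show False using le[of k] burn(2)[of k] \<open>v k = m\<close> by (simp add: w_def)
      qed
    qed
  next
    assume min: ?min
    \<comment> \<open>Toppling every vertex other than \<open>z\<close> once restores \<open>\<rho>\<close>.\<close>
    let ?one = "\<lambda>j. 1 - delta z j"
    have one_nonneg: "0 \<le> ?one j" for j by (simp add: delta_def)
    have "stable G {z} (\<lambda>j. ?\<beta> j + lap ?one j)"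
      using stab by (simp add: stable_singleton laplacian_diff laplacian_const)
    note one = one_nonneg this
    from stabilizing_sequence_exists[OF one] obtain "is" t
      where t: "topplings G {z} ?\<beta> is t" "stable G {z} t" by blast
    have le: "?u is j \<le> ?one j" for j by (rule least_action[OF t(1) one])
    let ?v = "\<lambda>j. ?u is j - ?one j"
    have z0: "count_list is z = 0" using topplings_sinks[OF t(1)] by simp
    have "stable_off z (\<lambda>j. \<rho> j + lap ?v j)"
      using t(2) topplings_result[OF t(1)]
      by (simp add: stable_singleton stable_off_def laplacian_diff laplacian_add laplacian_const
          algebra_simps)
    then have nonneg: "0 \<le> ?v j" for j
      using min[rule_format, of ?v j] z0 by simp
    have "count_list is j = 1" if "j \<noteq> z" for j
      using le[of j] nonneg[of j] that by simp
    then show ?burn using t by (intro exI[of _ "is"] exI[of _ t] conjI allI impI) auto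
  qed
  show ?thesis
    unfolding recurrent_def
  proof (intro conj_cong refl)
    show "(\<forall>i. i \<noteq> z \<longrightarrow> \<rho> i \<le> deg i - 1) = stable_off z \<rho>"
      by (simp add: stable_off_def)
    assume "stable_off z \<rho>"
    then show "(\<exists>is t. topplings G {z} ?\<beta> is t \<and> stable G {z} t \<and>
        (\<forall>i. i \<noteq> z \<longrightarrow> count_list is i = 1)) = ?min" by (rule burn_iff)
  qed
qed

lemma abs_le_Max: "\<bar>f i\<bar> \<le> Max (range (\<lambda>i. \<bar>f i :: int\<bar>))" for i :: 'v
  by (rule Max_ge) auto

lemma dominating_stabilizer_exists:
  obtains v :: "'v \<Rightarrow> int" where "v z = 0" "\<And>i. 0 \<le> v i" "\<And>i. i \<noteq> z \<Longrightarrow> s i + lap v i \<le> 0"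
proof -
  obtain h where h: "h z = 0" "\<And>i. 0 \<le> h i" "\<And>i. i \<noteq> z \<Longrightarrow> lap h i \<le> - 1"
    by (fact escape_function_exists[of z])
  define C where "C = Max (range (\<lambda>i. \<bar>s i\<bar>))"
  have C: "\<bar>s i\<bar> \<le> C" for i unfolding C_def by (rule abs_le_Max)
  have "0 \<le> C" using C[of z] by simp
  show thesis
  proof (rule that[of "\<lambda>i. C * h i"])
    fix i assume "i \<noteq> z"
    then have "C * lap h i \<le> C * (- 1)" using h(3) \<open>0 \<le> C\<close> by (intro mult_left_mono) auto
    then show "s i + lap (\<lambda>i. C * h i) i \<le> 0" using C[of i] by (simp add: laplacian_mult)
  qed (use h \<open>0 \<le> C\<close> in auto)
qed

lemma deg_nonneg: "0 \<le> deg i"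
  by (simp add: vdeg_def)

text \<open>
  A minimum principle: with a sufficiently superharmonic \<open>h\<close>, the sum \<open>v + h\<close> is strictly
  superharmonic off \<open>z\<close>, so it attains its minimum at \<open>z\<close>, where it is 0.
\<close>

lemma stabilizers_bounded_below:
  obtains h :: "'v \<Rightarrow> int" where
    "\<And>v. v z = 0 \<Longrightarrow> stable_off z (\<lambda>j. s j + lap v j) \<Longrightarrow> \<forall>j. h j \<le> v j"
proof -
  obtain h where h: "h z = 0" "\<And>i. 0 \<le> h i" "\<And>i. i \<noteq> z \<Longrightarrow> (deg i - s i) + lap h i \<le> 0"
    by (fact dominating_stabilizer_exists[of z "\<lambda>i. deg i - s i"])
  show thesis
  proof (rule that[of "\<lambda>j. - h j"])
    fix v assume v: "v z = 0" "stable_off z (\<lambda>j. s j + lap v j)"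
    let ?w = "\<lambda>j. v j + h j"
    have neg: "lap ?w i < 0" if "i \<noteq> z" for i
      using h(3)[OF that] v(2) that by (auto simp: laplacian_add stable_off_def)
    have "Min (range ?w) \<in> range ?w" by (intro Min_in) auto
    then obtain i where i: "?w i = Min (range ?w)" by (metis (mono_tags, lifting) imageE)
    then have le: "?w i \<le> ?w j" for j by simp
    have "0 \<le> lap ?w i" using le by (intro laplacian_at_min)
    then have "i = z" using neg[of i] by fastforce
    show "\<forall>j. - h j \<le> v j"
    proof
      fix j show "- h j \<le> v j" using le[of j] v(1) h(1) \<open>i = z\<close> by simp
    qed
  qed
qed

lemma stable_off_min:
  assumes "stable_off z (\<lambda>j. s j + lap v j)" and "stable_off z (\<lambda>j. s j + lap w j)"
  shows "stable_off z (\<lambda>j. s j + lap (\<lambda>j. min (v j) (w j)) j)"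
  unfolding stable_off_def
proof (intro allI impI)
  fix i assume "i \<noteq> z"
  have "lap (\<lambda>j. min (v j) (w j)) i \<le> lap v i \<or> lap (\<lambda>j. min (v j) (w j)) i \<le> lap w i"
  proof (cases "v i \<le> w i")
    case True
    then have "lap (\<lambda>j. min (v j) (w j)) i \<le> lap v i" by (intro laplacian_mono) auto
    then show ?thesis by simp
  next
    case False
    then have "lap (\<lambda>j. min (v j) (w j)) i \<le> lap w i" by (intro laplacian_mono) auto
    then show ?thesis by simp
  qed
  then show "s i + lap (\<lambda>j. min (v j) (w j)) i \<le> deg i - 1"
    using assms \<open>i \<noteq> z\<close> by (force simp: stable_off_def)
qed

text \<open>
  Functions whose Laplacian stabilizes \<open>s\<close> off \<open>z\<close> are closed under pointwise minimum. Those
  that vanish at \<open>z\<close> are bounded below, so one of minimal sum lies below all the others.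
\<close>

lemma least_stabilizer_exists:
  obtains v :: "'v \<Rightarrow> int" where "v z = 0" "stable_off z (\<lambda>j. s j + lap v j)"
    "\<And>w j. w z = 0 \<Longrightarrow> stable_off z (\<lambda>j. s j + lap w j) \<Longrightarrow> v j \<le> w j"
proof -
  let ?P = "\<lambda>v. v z = 0 \<and> stable_off z (\<lambda>j. s j + lap v j)"
  obtain h where h: "\<And>v. v z = 0 \<Longrightarrow> stable_off z (\<lambda>j. s j + lap v j) \<Longrightarrow> \<forall>j. h j \<le> v j"
    by (fact stabilizers_bounded_below[of z s])
  obtain v0 where "v0 z = 0" "\<And>i. 0 \<le> v0 i" "\<And>i. i \<noteq> z \<Longrightarrow> (s i - deg i + 1) + lap v0 i \<le> 0"
    by (fact dominating_stabilizer_exists[of z "\<lambda>i. s i - deg i + 1"])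
  then have "?P v0" by (force simp: stable_off_def)
  define size where "size v = nat (\<Sum>j\<in>UNIV. v j - h j)" for v :: "'v \<Rightarrow> int"
  obtain v where v: "?P v" and least: "\<And>w. ?P w \<Longrightarrow> size v \<le> size w"
    using ex_has_least_nat[of ?P v0 size] \<open>?P v0\<close> by blast
  show thesis
  proof (rule that)
    show "v z = 0" "stable_off z (\<lambda>j. s j + lap v j)" using v by auto
    fix w j assume w: "w z = 0" "stable_off z (\<lambda>j. s j + lap w j)"
    let ?m = "\<lambda>j. min (v j) (w j)"
    have Pm: "?P ?m" using v w stable_off_min by simp
    show "v j \<le> w j"
    proof (rule ccontr)
      assume "\<not> v j \<le> w j"
      then have "(\<Sum>j\<in>UNIV. ?m j - h j) < (\<Sum>j\<in>UNIV. v j - h j)"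
        by (intro sum_strict_mono_ex1 bexI[of _ j]) auto
      moreover have "0 \<le> (\<Sum>j\<in>UNIV. ?m j - h j)"
        using h[of ?m] Pm by (intro sum_nonneg) auto
      ultimately have "size ?m < size v" by (simp add: size_def)
      then show False using least[OF Pm] by simp
    qed
  qed
qed

lemma RecI:
  assumes "\<rho> z = deg z" "stable_off z \<rho>"
    and "\<And>v j. v z = 0 \<Longrightarrow> stable_off z (\<lambda>j. \<rho> j + lap v j) \<Longrightarrow> 0 \<le> v j"
  shows "\<rho> \<in> Rec G z"
  unfolding Rec_def using recurrent_iff_minimal assms by blast

lemma Rec_at_sink: "\<rho> \<in> Rec G z \<Longrightarrow> \<rho> z = deg z"
  and Rec_stable: "\<rho> \<in> Rec G z \<Longrightarrow> stable_off z \<rho>"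
  and Rec_minimal: "\<rho> \<in> Rec G z \<Longrightarrow> v z = 0 \<Longrightarrow> stable_off z (\<lambda>j. \<rho> j + lap v j) \<Longrightarrow> 0 \<le> v j"
  unfolding Rec_def using recurrent_iff_minimal by blast+

text \<open>
  If \<open>\<rho>(i) < 0\<close> for some \<open>i \<noteq> z\<close>, undoing a toppling of \<open>i\<close> would leave \<open>\<rho>\<close> stable off
  \<open>z\<close>, contrary to minimality.
\<close>

lemma Rec_nonneg:
  assumes "\<rho> \<in> Rec G z"
  shows "0 \<le> \<rho> i"
proof (cases "i = z")
  case True
  then show ?thesis using Rec_at_sink[OF assms] deg_nonneg by simp
next
  case False
  let ?v = "\<lambda>j. - delta i j"
  have "\<not> stable_off z (\<lambda>j. \<rho> j + lap ?v j)"
    using Rec_minimal[OF assms, of ?v i] False by auto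
  then obtain j where j: "j \<noteq> z" "deg j - 1 < \<rho> j + lap ?v j"
    by (auto simp: stable_off_def not_le)
  have "j = i"
  proof (rule ccontr)
    assume "j \<noteq> i"
    then have "0 \<le> lap (delta i) j"
      by (intro laplacian_at_min) (simp add: delta_nonneg)
    then show False
      using j Rec_stable[OF assms] by (force simp: stable_off_def laplacian_uminus)
  qed
  moreover have "- deg i \<le> lap (delta i) i"
    by (simp add: laplacian_def sum_nonneg delta_nonneg)
  ultimately show ?thesis using j by (simp add: laplacian_uminus)
qed

lemma finite_Rec: "finite (Rec G z)"
proof (rule finite_subset)
  show "Rec G z \<subseteq> Pi\<^sub>E UNIV (\<lambda>i. {0..deg i})"
  proof
    fix \<rho> assume \<rho>: "\<rho> \<in> Rec G z"
    have "\<rho> i \<le> deg i" for i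
      using Rec_at_sink[OF \<rho>] Rec_stable[OF \<rho>] by (cases "i = z") (force simp: stable_off_def)+
    then show "\<rho> \<in> Pi\<^sub>E UNIV (\<lambda>i. {0..deg i})" using Rec_nonneg[OF \<rho>] by auto
  qed
qed (simp add: finite_PiE)

text \<open>
  Equality modulo \<open>\<Delta>\<close> and \<open>\<delta>\<^sub>z\<close>. Disregarding the value at \<open>z\<close> absorbs the multiple
  of \<open>\<delta>\<^sub>z\<close>, and since constants are harmonic \<open>v(z)\<close> may be left free here.
\<close>

definition equiv_off :: "'v \<Rightarrow> 'v sandpile \<Rightarrow> 'v sandpile \<Rightarrow> bool" where
  "equiv_off z s t \<longleftrightarrow> (\<exists>v. \<forall>j. j \<noteq> z \<longrightarrow> s j = t j + lap v j)"

lemma laplacian_shift: "lap (\<lambda>j. v j - c) i = lap v i"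
  by (simp add: laplacian_diff laplacian_const)

lemma equiv_offE:
  assumes "equiv_off z s t"
  obtains v where "v z = 0" "\<And>j. j \<noteq> z \<Longrightarrow> s j = t j + lap v j"
proof -
  obtain v where v: "\<And>j. j \<noteq> z \<Longrightarrow> s j = t j + lap v j"
    using assms by (auto simp: equiv_off_def)
  show thesis
    by (rule that[of "\<lambda>j. v j - v z"]) (use v in \<open>auto simp: laplacian_shift\<close>)
qed

lemma equiv_offI: "(\<And>j. j \<noteq> z \<Longrightarrow> s j = t j + lap v j) \<Longrightarrow> equiv_off z s t"
  by (auto simp: equiv_off_def)

lemma equiv_off_sym: "equiv_off z s t \<Longrightarrow> equiv_off z t s"
  by (elim equiv_offE, rule equiv_offI[where v = "\<lambda>j. - v j" for v]) (simp add: laplacian_uminus)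

lemma equiv_off_trans: "equiv_off z r s \<Longrightarrow> equiv_off z s t \<Longrightarrow> equiv_off z r t"
  by (elim equiv_offE, rule equiv_offI[where v = "\<lambda>j. v j + w j" for v w])
    (simp add: laplacian_add)

lemma equiv_off_add_chip: "equiv_off z s t \<Longrightarrow> equiv_off z (add_chip s i) (add_chip t i)"
  by (auto simp: equiv_off_def add_chip_def)

lemma equiv_off_add_chip_iff: "equiv_off z (add_chip s i) (add_chip t i) \<longleftrightarrow> equiv_off z s t"
  by (auto simp: equiv_off_def add_chip_def)

text \<open>
  For \<open>\<rho> = \<rho>' + \<Delta> v\<close> off \<open>z\<close>, minimality of \<open>\<rho>'\<close> gives \<open>v \<ge> 0\<close> and
  minimality of \<open>\<rho>\<close> gives \<open>-v \<ge> 0\<close>.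
\<close>

lemma Rec_equiv_eq:
  assumes "\<rho> \<in> Rec G z" "\<rho>' \<in> Rec G z" "equiv_off z \<rho> \<rho>'"
  shows "\<rho> = \<rho>'"
proof
  obtain v where v: "v z = 0" "\<And>j. j \<noteq> z \<Longrightarrow> \<rho> j = \<rho>' j + lap v j"
    by (fact equiv_offE[OF assms(3)])
  have "stable_off z (\<lambda>j. \<rho>' j + lap v j)"
    using Rec_stable[OF assms(1)] v(2) by (simp add: stable_off_def)
  then have "0 \<le> v j" for j using Rec_minimal[OF assms(2)] v(1) by blast
  moreover have "stable_off z (\<lambda>j. \<rho> j + lap (\<lambda>j. - v j) j)"
    using Rec_stable[OF assms(2)] v(2) by (simp add: stable_off_def laplacian_uminus)
  then have "0 \<le> - v j" for j
    using Rec_minimal[OF assms(1), of "\<lambda>j. - v j"] v(1) by simp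
  ultimately have "v = (\<lambda>j. 0)" by (intro ext) (simp add: order_antisym)
  fix j show "\<rho> j = \<rho>' j"
    using v(2)[of j] Rec_at_sink[OF assms(1)] Rec_at_sink[OF assms(2)] \<open>v = _\<close>
    by (cases "j = z") (auto simp: laplacian_const)
qed

text \<open>
  Once the least stabilizer of \<open>s\<close> has been applied, every further stabilizer that vanishes at
  \<open>z\<close> is nonnegative.
\<close>

lemma Rec_equiv_exists: "\<exists>\<rho>\<in>Rec G z. equiv_off z s \<rho>"
proof -
  obtain v where v: "v z = 0" "stable_off z (\<lambda>j. s j + lap v j)"
    "\<And>w j. w z = 0 \<Longrightarrow> stable_off z (\<lambda>j. s j + lap w j) \<Longrightarrow> v j \<le> w j"
    by (fact least_stabilizer_exists[of z s])
  let ?\<rho> = "\<lambda>j. if j = z then deg z else s j + lap v j"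
  have "?\<rho> \<in> Rec G z"
  proof (rule RecI)
    show "stable_off z ?\<rho>" using v(2) by (simp add: stable_off_def)
    fix w j assume w: "w z = 0" "stable_off z (\<lambda>j. ?\<rho> j + lap w j)"
    have "stable_off z (\<lambda>j. s j + lap (\<lambda>j. v j + w j) j)"
      using w(2) by (simp add: stable_off_def laplacian_add add.assoc)
    from v(3)[OF _ this, of j] show "0 \<le> w j" using v(1) w(1) by simp
  qed simp
  moreover have "equiv_off z s ?\<rho>"
    by (rule equiv_offI[where v = "\<lambda>j. - v j"]) (simp add: laplacian_uminus)
  ultimately show ?thesis by blast
qed

lemma equiv_off_iff_decomposition:
  "equiv_off z s \<rho> \<longleftrightarrow>
     (\<exists>(m::int) v. v z = 0 \<and> s = (\<lambda>j. \<rho> j + m * delta z j + lap v j))"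
proof
  assume equiv: "equiv_off z s \<rho>"
  obtain v where v: "v z = 0" "\<And>j. j \<noteq> z \<Longrightarrow> s j = \<rho> j + lap v j"
    by (fact equiv_offE[OF equiv])
  have "s = (\<lambda>j. \<rho> j + (s z - \<rho> z - lap v z) * delta z j + lap v j)"
    using v(2) by (auto simp: delta_def fun_eq_iff)
  then show "\<exists>(m::int) v. v z = 0 \<and> s = (\<lambda>j. \<rho> j + m * delta z j + lap v j)"
    using v(1) by blast
next
  assume "\<exists>(m::int) v. v z = 0 \<and> s = (\<lambda>j. \<rho> j + m * delta z j + lap v j)"
  then obtain m v where "s = (\<lambda>j. \<rho> j + m * delta z j + lap v j)" by blast
  then show "equiv_off z s \<rho>" by (intro equiv_offI[where v = v]) simp
qed

lemma rec_rep_eqI: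
  assumes "\<rho> \<in> Rec G z" "equiv_off z s \<rho>"
  shows "rec_rep G z s = \<rho>"
  unfolding rec_rep_def equiv_off_iff_decomposition[symmetric]
  using assms by (blast intro: Rec_equiv_eq equiv_off_trans equiv_off_sym)

lemma rec_rep_Rec: "rec_rep G z s \<in> Rec G z"
  and rec_rep_equiv: "equiv_off z s (rec_rep G z s)"
  using Rec_equiv_exists[of z s] rec_rep_eqI by blast+

lemma rec_rep_eq_iff: "rec_rep G z s = rec_rep G z t \<longleftrightarrow> equiv_off z s t"
  by (metis equiv_off_sym equiv_off_trans rec_rep_Rec rec_rep_eqI rec_rep_equiv)

lemma rec_rep_of_Rec: "\<rho> \<in> Rec G z \<Longrightarrow> rec_rep G z \<rho> = \<rho>"
  by (rule rec_rep_eqI) (auto intro: equiv_offI[where v = "\<lambda>_. 0"] simp: laplacian_const)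

text \<open>
  The multiple of \<open>\<delta>\<^sub>z\<close> is found by counting chips.
\<close>

lemma rec_rep_decomposition:
  obtains v where "v z = 0"
    "\<And>j. s j = rec_rep G z s j + (chips s - chips (rec_rep G z s)) * delta z j + lap v j"
proof -
  from rec_rep_equiv[of z s] obtain m v where mv: "v z = 0"
    "s = (\<lambda>j. rec_rep G z s j + m * delta z j + lap v j)"
    unfolding equiv_off_iff_decomposition by blast
  have "chips s = chips (rec_rep G z s) + (\<Sum>j\<in>UNIV. m * delta z j) + chips (lap v)"
    unfolding chips_def by (subst mv(2)) (simp add: sum.distrib)
  also have "(\<Sum>j\<in>UNIV. m * delta z j) = m"
    by (simp add: delta_def if_distrib cong: if_cong)
  finally have "m = chips s - chips (rec_rep G z s)" by (simp add: chips_laplacian)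
  then show thesis using that mv by metis
qed

text \<open>
  Write \<open>s = \<rho> + m \<delta>\<^sub>z + \<Delta> v\<close>. If \<open>m < 0\<close>, then \<open>\<rho> + m \<delta>\<^sub>z\<close> is stable and it is
  reached by \<open>c - v \<ge> 0\<close> for a large constant \<open>c\<close>. Conversely, a stable sandpile in the class
  is \<open>\<rho> + m \<delta>\<^sub>z + \<Delta> w\<close> with \<open>w(z) = 0\<close>; minimality gives \<open>w \<ge> 0\<close>, so
  \<open>z\<close> holds at least \<open>deg(z) + m\<close> chips.
\<close>

lemma stabilizable_iff: "stabilizable G {} s \<longleftrightarrow> chips s < chips (rec_rep G z s)"
proof -
  let ?\<rho> = "rec_rep G z s" and ?m = "chips s - chips (rec_rep G z s)"
  obtain v where v: "v z = 0" "\<And>j. s j = ?\<rho> j + ?m * delta z j + lap v j"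
    by (fact rec_rep_decomposition[of z s])
  note \<rho> = rec_rep_Rec[of z s]
  show ?thesis
  proof
    assume "stabilizable G {} s"
    then obtain "is" t where t: "topplings G {} s is t" "stable G {} t"
      by (auto simp: stabilizable_def)
    define u where "u = (\<lambda>j. int (count_list is j))"
    \<comment> \<open>Normalized so that \<open>w z = 0\<close>, which does not change the Laplacian.\<close>
    define w where "w = (\<lambda>j. v j + u j - u z)"
    have w: "t j = ?\<rho> j + ?m * delta z j + lap w j" for j
      using topplings_result[OF t(1), of j] v(2)[of j]
      by (simp add: w_def laplacian_add laplacian_shift u_def)
    have stab: "t j \<le> deg j - 1" for j using t(2) by (simp add: stable_def)
    have "stable_off z (\<lambda>j. ?\<rho> j + lap w j)"
      unfolding stable_off_def
    proof (intro allI impI)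
      fix i assume "i \<noteq> z"
      then show "?\<rho> i + lap w i \<le> deg i - 1" using stab[of i] w[of i] by simp
    qed
    moreover have "w z = 0" by (simp add: w_def v(1))
    ultimately have "0 \<le> w j" for j using Rec_minimal[OF \<rho>] by blast
    then have "0 \<le> lap w z" using \<open>w z = 0\<close> by (intro laplacian_at_min) simp
    then show "chips s < chips ?\<rho>" using stab[of z] w[of z] Rec_at_sink[OF \<rho>] by simp
  next
    assume "chips s < chips ?\<rho>"
    then have m: "?m \<le> - 1" by simp
    define c where "c = Max (range (\<lambda>i. \<bar>v i\<bar>))"
    have c: "v i \<le> c" for i unfolding c_def by (rule order_trans[OF abs_ge_self abs_le_Max])
    let ?w = "\<lambda>j. c - v j"
    have "stable G {} (\<lambda>j. s j + lap ?w j)"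
      unfolding stable_def
    proof (intro allI impI)
      fix j
      have "s j + lap ?w j = ?\<rho> j + ?m * delta z j"
        using v(2)[of j] by (simp add: laplacian_diff laplacian_const)
      also have "\<dots> \<le> deg j - 1"
        using m Rec_at_sink[OF \<rho>] Rec_stable[OF \<rho>] by (cases "j = z") (auto simp: stable_off_def)
      finally show "s j + lap ?w j \<le> deg j - 1" .
    qed
    then show "stabilizable G {} s"
      unfolding stabilizable_def by (intro stabilizing_sequence_exists[of ?w]) (simp add: c)
  qed
qed

text \<open>
  The toppling numbers \<open>u\<close> of the stabilization are below every nonnegative stabilizer of
  \<open>\<rho> + \<delta>\<^sub>i\<close>. By minimality of \<open>\<rho>\<close> every stabilizer of \<open>\<rho> + \<delta>\<^sub>i\<close> that vanishes at
  \<open>z\<close> is nonnegative, so \<open>u\<close> is the least of them and the result is again minimal. The chips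
  that vanish are those flowing into the sink.
\<close>

lemma open_add_properties:
  assumes \<rho>: "\<rho> \<in> Rec G z"
  shows open_add_eq_rec_rep: "open_add G z i \<rho> = rec_rep G z (add_chip \<rho> i)"
    and chips_open_add_le: "chips (open_add G z i \<rho>) \<le> chips \<rho> + 1"
proof -
  let ?s = "add_chip \<rho> i"
  obtain v0 where v0: "v0 z = 0" "\<And>j. 0 \<le> v0 j"
    "\<And>j. j \<noteq> z \<Longrightarrow> (?s j - deg j + 1) + lap v0 j \<le> 0"
    by (fact dominating_stabilizer_exists[of z "\<lambda>j. ?s j - deg j + 1"])
  have "stable G {z} (\<lambda>j. ?s j + lap v0 j)" using v0(3) by (force simp: stable_def)
  from stabilizing_sequence_exists[OF v0(2) this] obtain "is" t
    where t: "topplings G {z} ?s is t" "stable G {z} t" by blast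
  define u where "u = (\<lambda>j. int (count_list is j))"
  have "u z = 0" using topplings_sinks[OF t(1)] by (simp add: u_def)
  have tj: "t j = ?s j + lap u j" if "j \<noteq> z" for j
    using topplings_result[OF t(1), of j] that by (simp add: u_def)
  let ?t = "t(z := deg z)"
  have eq: "open_add G z i \<rho> = ?t" using stabilization_eqI[OF t] by (simp add: open_add_def)
  have "?t \<in> Rec G z"
  proof (rule RecI)
    show "stable_off z ?t" using t(2) by (simp add: stable_singleton stable_off_def)
    fix v j assume v: "v z = 0" "stable_off z (\<lambda>j. ?t j + lap v j)"
    have stab: "stable_off z (\<lambda>j. ?s j + lap (\<lambda>j. u j + v j) j)"
      using v(2) tj by (simp add: stable_off_def laplacian_add add.assoc)
    have "\<rho> j + lap w j \<le> ?s j + lap w j" for w j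
      by (simp add: add_chip_def delta_nonneg)
    then have "stable_off z (\<lambda>j. \<rho> j + lap (\<lambda>j. u j + v j) j)"
      using stab unfolding stable_off_def by (meson order_trans)
    then have "0 \<le> u j + v j" for j
      using Rec_minimal[OF \<rho>, of "\<lambda>j. u j + v j"] v(1) \<open>u z = 0\<close> by simp
    then have "int (count_list is j) \<le> u j + v j"
      using stab by (intro least_action[where v = "\<lambda>j. u j + v j", OF t(1)])
        (simp_all add: stable_singleton)
    then show "0 \<le> v j" by (simp add: u_def)
  qed simp
  moreover have "equiv_off z ?s ?t"
    by (rule equiv_offI[where v = "\<lambda>j. - u j"]) (simp add: tj laplacian_uminus)
  ultimately show "open_add G z i \<rho> = rec_rep G z ?s" using rec_rep_eqI eq by simp
  have "0 \<le> lap u z" using \<open>u z = 0\<close> by (intro laplacian_at_min) (simp add: u_def)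
  then have "?t j \<le> ?s j + lap u j" for j
    using tj[of j] Rec_at_sink[OF \<rho>] by (cases "j = z") (auto simp: add_chip_def delta_def)
  then have "chips ?t \<le> chips (\<lambda>j. ?s j + lap u j)" unfolding chips_def by (rule sum_mono)
  also have "\<dots> = chips ?s + chips (lap u)" by (simp add: chips_def sum.distrib)
  also have "chips ?s = chips \<rho> + 1"
    by (simp add: chips_def add_chip_def sum.distrib delta_def)
  finally show "chips (open_add G z i \<rho>) \<le> chips \<rho> + 1" by (simp only: eq chips_laplacian add_0_right)
qed

lemma open_add_rec_rep: "open_add G z i (rec_rep G z s) = rec_rep G z (add_chip s i)"
  by (simp add: open_add_eq_rec_rep rec_rep_Rec rec_rep_eq_iff equiv_off_add_chip
      equiv_off_sym rec_rep_equiv)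

lemma bij_betw_open_add: "bij_betw (open_add G z i) (Rec G z) (Rec G z)"
proof -
  have "inj_on (open_add G z i) (Rec G z)"
  proof
    fix \<rho> \<rho>' assume "\<rho> \<in> Rec G z" "\<rho>' \<in> Rec G z" "open_add G z i \<rho> = open_add G z i \<rho>'"
    then show "\<rho> = \<rho>'"
      by (simp add: open_add_eq_rec_rep rec_rep_eq_iff equiv_off_add_chip_iff Rec_equiv_eq)
  qed
  moreover have "open_add G z i ` Rec G z \<subseteq> Rec G z"
    using open_add_eq_rec_rep rec_rep_Rec by auto
  ultimately show ?thesis
    using endo_inj_surj[OF finite_Rec] by (simp add: bij_betw_def)
qed

lemma open_add_sink: "\<rho> \<in> Rec G z \<Longrightarrow> open_add G z z \<rho> = \<rho>"
  by (simp add: open_add_eq_rec_rep, rule rec_rep_eqI)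
    (auto intro: equiv_offI[where v = "\<lambda>_. 0"] simp: laplacian_const add_chip_def)

lemma burst_open_add:
  "\<rho> \<in> Rec G z \<Longrightarrow> burst G z i (open_add G z i \<rho>) = chips \<rho> - chips (open_add G z i \<rho>) + 1"
  using bij_betw_open_add by (simp add: burst_def bij_betw_def)

lemma fold_open_add_rec_rep:
  "fold (open_add G z) w (rec_rep G z s) = rec_rep G z (\<lambda>j. s j + int (count_list w j))"
proof (induction w arbitrary: s)
  case (Cons i w)
  have "(\<lambda>j. add_chip s i j + int (count_list w j)) = (\<lambda>j. s j + int (count_list (i # w) j))"
    by (auto simp: add_chip_def delta_def)
  then show ?case by (simp only: fold_Cons o_apply open_add_rec_rep Cons.IH)
qed simp

lemma list_with_counts: "\<exists>w. \<forall>j. count_list w j = c j" for c :: "'v \<Rightarrow> nat"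
proof -
  obtain w where "mset w = Abs_multiset c" using ex_mset by blast
  then have "count (mset w) j = c j" for j by (simp add: Abs_multiset_inverse)
  then show ?thesis by (auto simp: count_mset)
qed

text \<open>
  Subtracting a suitable Laplacian turns \<open>\<eta> - \<rho>\<close> into a function that is nonnegative off
  \<open>z\<close>, that is, into chips to be added one by one.
\<close>

lemma open_add_irreducible:
  assumes \<rho>: "\<rho> \<in> Rec G z" and \<eta>: "\<eta> \<in> Rec G z"
  shows "\<exists>w. fold (open_add G z) w \<rho> = \<eta>"
proof -
  obtain v where v: "v z = 0" "\<And>j. 0 \<le> v j" "\<And>j. j \<noteq> z \<Longrightarrow> (\<rho> j - \<eta> j) + lap v j \<le> 0"
    by (fact dominating_stabilizer_exists[of z "\<lambda>j. \<rho> j - \<eta> j"])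
  obtain w where w: "\<And>j. count_list w j = nat (\<eta> j - \<rho> j - lap v j)"
    using list_with_counts[of "\<lambda>j. nat (\<eta> j - \<rho> j - lap v j)"] by auto
  have "equiv_off z (\<lambda>j. \<rho> j + int (count_list w j)) \<eta>"
    by (rule equiv_offI[where v = "\<lambda>j. - v j"]) (use v(3) in \<open>force simp: w laplacian_uminus\<close>)
  then have "rec_rep G z (\<lambda>j. \<rho> j + int (count_list w j)) = \<eta>"
    by (rule rec_rep_eqI[OF \<eta>])
  then show ?thesis using fold_open_add_rec_rep[of z w \<rho>] by (auto simp: rec_rep_of_Rec \<rho>)
qed

section \<open>The closed chain modulo the Laplacian\<close>

text \<open>
  Both cases in the definition of the closed step add a chip and then a Laplacian, so the class
  of the chain is a random walk that continues past the threshold time.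
\<close>

lemma closed_add_properties:
  shows rec_rep_closed_add: "rec_rep G z (closed_add G i s) = open_add G z i (rec_rep G z s)"
    and chips_closed_add: "chips (closed_add G i s) = chips s + 1"
proof -
  have "\<exists>u. closed_add G i s = (\<lambda>j. add_chip s i j + lap u j)"
  proof (cases "stabilizable G {} (add_chip s i)")
    case True
    then obtain "is" t where t: "topplings G {} (add_chip s i) is t" "stable G {} t"
      by (auto simp: stabilizable_def)
    then show ?thesis
      using topplings_result[OF t(1)] stabilization_eqI[OF t] True by (auto simp: closed_add_def)
  next
    case False
    then show ?thesis by (auto simp: closed_add_def laplacian_const intro!: exI[of _ "\<lambda>_. 0"])
  qed
  then obtain u where u: "closed_add G i s = (\<lambda>j. add_chip s i j + lap u j)" by blast
  then have "equiv_off z (closed_add G i s) (add_chip s i)" by (auto intro: equiv_offI)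
  then show "rec_rep G z (closed_add G i s) = open_add G z i (rec_rep G z s)"
    by (simp add: open_add_rec_rep rec_rep_eq_iff)
  have "chips (closed_add G i s) = chips s + 1 + chips (lap u)"
    by (simp add: u chips_def add_chip_def sum.distrib delta_def)
  then show "chips (closed_add G i s) = chips s + 1" by (simp add: chips_laplacian)
qed

lemma chips_closed_chain: "chips (closed_chain G x s0 k) = chips s0 + int k"
  by (induction k) (simp_all add: chips_closed_add)

lemma rec_rep_closed_chain:
  "rec_rep G z (closed_chain G x s0 k) =
     fold (open_add G z) (map (\<lambda>j. x (Suc j)) [0..<k]) (rec_rep G z s0)"
  by (induction k) (simp_all add: rec_rep_closed_add)

end

section \<open>Random walks by permutations of a finite set\<close>

text \<open>
  The Markov operator of the walk that applies \<open>g i\<close> with probability \<open>p i\<close>.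
\<close>

definition expected_step :: "'i::finite pmf \<Rightarrow> ('i \<Rightarrow> 's \<Rightarrow> 's) \<Rightarrow> ('s \<Rightarrow> real) \<Rightarrow> 's \<Rightarrow> real" where
  "expected_step p g f x = (\<Sum>i\<in>UNIV. pmf p i * f (g i x))"

lemma sum_pmf_UNIV: "(\<Sum>i\<in>UNIV. pmf p i) = 1" for p :: "'i::finite pmf"
  by (rule sum_pmf_eq_1) auto

locale permutation_walk =
  fixes p :: "'i::finite pmf" and g :: "'i \<Rightarrow> 's \<Rightarrow> 's" and S :: "'s set" and z :: 'i
  assumes pmf_pos: "\<And>i. 0 < pmf p i"
    and finite_states: "finite S"
    and nonempty: "S \<noteq> {}"
    and bij: "\<And>i. bij_betw (g i) S S"
    and idle: "\<And>x. x \<in> S \<Longrightarrow> g z x = x"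
    and irreducible: "\<And>x y. x \<in> S \<Longrightarrow> y \<in> S \<Longrightarrow> \<exists>w. fold g w x = y"
begin

abbreviation T :: "('s \<Rightarrow> real) \<Rightarrow> 's \<Rightarrow> real" where
  "T \<equiv> expected_step p g"

lemma step_closed: "x \<in> S \<Longrightarrow> g i x \<in> S"
  using bij[of i] by (auto simp: bij_betw_def)

lemma fold_closed: "x \<in> S \<Longrightarrow> fold g w x \<in> S"
  by (induction w arbitrary: x) (auto simp: step_closed)

lemma iterate_ge:
  assumes "\<And>y. y \<in> S \<Longrightarrow> a \<le> f y" and "x \<in> S"
  shows "a \<le> (T ^^ n) f x"
  using assms(2)
proof (induction n arbitrary: x)
  case (Suc n)
  have "a = (\<Sum>i\<in>UNIV. pmf p i * a)" by (simp add: sum_pmf_UNIV flip: sum_distrib_right)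
  also have "\<dots> \<le> (\<Sum>i\<in>UNIV. pmf p i * (T ^^ n) f (g i x))"
    using Suc by (intro sum_mono mult_left_mono) (auto simp: step_closed)
  finally show ?case by (simp add: expected_step_def[of p g "(T ^^ n) f"])
qed (use assms(1) in simp)

lemma iterate_diff_const: "(T ^^ n) (\<lambda>x. f x - c) x = (T ^^ n) f x - c"
proof (induction n arbitrary: x)
  case (Suc n)
  have "T ((T ^^ n) (\<lambda>x. f x - c)) x = (\<Sum>i\<in>UNIV. pmf p i * ((T ^^ n) f (g i x) - c))"
    unfolding expected_step_def using Suc by (simp add: expected_step_def)
  also have "\<dots> = T ((T ^^ n) f) x - (\<Sum>i\<in>UNIV. pmf p i) * c"
    by (simp add: expected_step_def right_diff_distrib sum_subtractf sum_distrib_right)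
  finally show ?case by (simp add: sum_pmf_UNIV)
qed simp

lemma iterate_uminus: "(T ^^ n) (\<lambda>x. - f x) x = - (T ^^ n) f x"
proof (induction n arbitrary: x)
  case (Suc n)
  then show ?case by (simp add: expected_step_def[of p g "(T ^^ n) _"] sum_negf)
qed simp

lemma iterate_le:
  assumes "\<And>y. y \<in> S \<Longrightarrow> f y \<le> a" and "x \<in> S"
  shows "(T ^^ n) f x \<le> a"
  using iterate_ge[of "- a" "\<lambda>x. - f x" x n] assms by (simp add: iterate_uminus)

text \<open>
  The uniform distribution is invariant because every \<open>g i\<close> is a permutation.
\<close>

lemma sum_iterate: "(\<Sum>x\<in>S. (T ^^ n) f x) = (\<Sum>x\<in>S. f x)"
proof (induction n)
  case (Suc n)
  have "(\<Sum>x\<in>S. T ((T ^^ n) f) x) = (\<Sum>i\<in>UNIV. pmf p i * (\<Sum>x\<in>S. (T ^^ n) f (g i x)))"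
    unfolding expected_step_def[of p g "(T ^^ n) f"]
    by (subst sum.swap) (simp add: sum_distrib_left)
  also have "\<dots> = (\<Sum>i\<in>UNIV. pmf p i * (\<Sum>x\<in>S. (T ^^ n) f x))"
    using sum.reindex_bij_betw[OF bij, of "(T ^^ n) f"] by simp
  also have "\<dots> = (\<Sum>x\<in>S. (T ^^ n) f x)"
    by (simp add: sum_pmf_UNIV flip: sum_distrib_right)
  finally show ?case using Suc by simp
qed simp

definition min_prob :: real where "min_prob = Min (range (pmf p))"

lemma min_prob_pos: "0 < min_prob"
  by (auto simp: min_prob_def pmf_pos)

lemma min_prob_le: "min_prob \<le> pmf p i"
  by (simp add: min_prob_def)

lemma iterate_ge_path:
  assumes "\<And>y. y \<in> S \<Longrightarrow> 0 \<le> f y" and "x \<in> S"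
  shows "min_prob ^ length w * f (fold g w x) \<le> (T ^^ length w) f x"
  using assms(2)
proof (induction w arbitrary: x)
  case (Cons i w)
  let ?f = "(T ^^ length w) f"
  have nonneg: "0 \<le> ?f (g j x)" for j
    using Cons.prems by (intro iterate_ge assms step_closed)
  have "min_prob ^ length (i # w) * f (fold g (i # w) x)
      = min_prob * (min_prob ^ length w * f (fold g w (g i x)))"
    by simp
  also have "\<dots> \<le> pmf p i * ?f (g i x)"
    using Cons.IH[of "g i x"] Cons.prems min_prob_pos min_prob_le assms(1)
    by (intro mult_mono) (auto simp: step_closed fold_closed)
  also have "\<dots> \<le> (\<Sum>j\<in>UNIV. pmf p j * ?f (g j x))"
    using nonneg by (intro member_le_sum) auto
  finally show ?case by (simp add: expected_step_def[of p g ?f])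
qed simp

lemma idle_funpow: "x \<in> S \<Longrightarrow> (g z ^^ n) x = x"
  by (induction n) (auto simp: idle)

text \<open>
  Paths of different lengths are padded with the idle letter; this is where aperiodicity comes
  from.
\<close>

lemma uniform_length_paths:
  "\<exists>n. \<forall>x\<in>S. \<forall>y\<in>S. \<exists>w. length w = n \<and> fold g w x = y"
proof -
  have "\<forall>q\<in>S \<times> S. \<exists>w. fold g w (fst q) = snd q" using irreducible by auto
  then obtain w where w: "\<And>x y. x \<in> S \<Longrightarrow> y \<in> S \<Longrightarrow> fold g (w (x, y)) x = y"
    by (metis SigmaI fst_conv snd_conv)
  define n where "n = Max ((\<lambda>q. length (w q)) ` (S \<times> S))"
  have "length (w (x, y)) \<le> n" if "x \<in> S" "y \<in> S" for x y
    unfolding n_def using that finite_states by (intro Max_ge) auto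
  then have "length (w (x, y) @ replicate (n - length (w (x, y))) z) = n
      \<and> fold g (w (x, y) @ replicate (n - length (w (x, y))) z) x = y"
    if "x \<in> S" "y \<in> S" for x y
    using that by (simp add: w idle_funpow)
  then show ?thesis by blast
qed

text \<open>
  Doeblin's argument. From every state the walk reaches a maximum point of \<open>f\<close> in exactly
  \<open>n\<close> steps with probability at least \<open>c\<close>, which raises the minimum of the iterate by
  \<open>c\<close> times the spread of \<open>f\<close>, while the maximum does not grow.
\<close>

lemma contraction:
  "\<exists>c n. 0 < c \<and> c \<le> 1 \<and> (\<forall>f d. (\<forall>x\<in>S. \<forall>y\<in>S. f x - f y \<le> d) \<longrightarrow>
     (\<forall>x\<in>S. \<forall>y\<in>S. (T ^^ n) f x - (T ^^ n) f y \<le> (1 - c) * d))"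
proof -
  obtain n where n: "\<And>x y. x \<in> S \<Longrightarrow> y \<in> S \<Longrightarrow> \<exists>w. length w = n \<and> fold g w x = y"
    using uniform_length_paths by blast
  let ?c = "min_prob ^ n"
  have "min_prob \<le> 1" using min_prob_le[of z] pmf_le_1[of p z] by linarith
  show ?thesis
  proof (rule exI[of _ ?c], rule exI[of _ n], intro conjI allI impI ballI)
    show "0 < ?c" using min_prob_pos by simp
    show c1: "?c \<le> 1" using \<open>min_prob \<le> 1\<close> min_prob_pos by (intro power_le_one) auto
    fix f :: "'s \<Rightarrow> real" and d :: real and x y
    assume d: "\<forall>x\<in>S. \<forall>y\<in>S. f x - f y \<le> d" and x: "x \<in> S" and y: "y \<in> S"
    have "Max (f ` S) \<in> f ` S" "Min (f ` S) \<in> f ` S"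
      using finite_states nonempty by (auto intro!: Max_in Min_in)
    then obtain a b where a: "a \<in> S" "f a = Max (f ` S)" and b: "b \<in> S" "f b = Min (f ` S)"
      by (metis imageE)
    have le_a: "f u \<le> f a" and ge_b: "f b \<le> f u" if "u \<in> S" for u
      using that finite_states by (auto simp: a b)
    obtain w where w: "length w = n" "fold g w y = a" using n y a by blast
    have "?c * (f a - f b) \<le> (T ^^ n) (\<lambda>u. f u - f b) y"
      using iterate_ge_path[of "\<lambda>u. f u - f b" y w] ge_b y w by simp
    then have "?c * (f a - f b) \<le> (T ^^ n) f y - f b" by (simp add: iterate_diff_const)
    moreover have "(T ^^ n) f x \<le> f a" using le_a x by (intro iterate_le)
    ultimately have "(T ^^ n) f x - (T ^^ n) f y \<le> (1 - ?c) * (f a - f b)"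
      by (simp add: algebra_simps)
    also have "\<dots> \<le> (1 - ?c) * d" using d[rule_format, OF a(1) b(1)] c1 by (intro mult_left_mono) auto
    finally show "(T ^^ n) f x - (T ^^ n) f y \<le> (1 - ?c) * d" .
  qed
qed

lemma spread_tendsto_0:
  assumes "0 < \<epsilon>"
  shows "\<exists>N. \<forall>k\<ge>N. \<forall>x\<in>S. \<forall>y\<in>S. (T ^^ k) f x - (T ^^ k) f y \<le> \<epsilon>"
proof -
  obtain c n where c: "0 < c" "c \<le> 1" and contr:
    "\<And>f d x y. \<forall>x\<in>S. \<forall>y\<in>S. f x - f y \<le> d \<Longrightarrow> x \<in> S \<Longrightarrow> y \<in> S \<Longrightarrow>
       (T ^^ n) f x - (T ^^ n) f y \<le> (1 - c) * d"
    using contraction by blast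
  define d where "d = Max (f ` S) - Min (f ` S)"
  have d: "f x - f y \<le> d" if "x \<in> S" "y \<in> S" for x y
    unfolding d_def using that finite_states by (intro diff_mono) auto
  have iter: "(T ^^ (n * q)) f x - (T ^^ (n * q)) f y \<le> (1 - c) ^ q * d" if "x \<in> S" "y \<in> S" for q x y
    using that
  proof (induction q arbitrary: x y)
    case (Suc q)
    have "(T ^^ n) ((T ^^ (n * q)) f) x - (T ^^ n) ((T ^^ (n * q)) f) y \<le> (1 - c) * ((1 - c) ^ q * d)"
      using Suc by (intro contr) auto
    then show ?case by (simp add: funpow_add mult.assoc)
  qed (simp add: d)
  have "(\<lambda>q. (1 - c) ^ q * d) \<longlonglongrightarrow> 0 * d"
    using c by (intro tendsto_intros LIMSEQ_power_zero) auto
  then have "eventually (\<lambda>q. (1 - c) ^ q * d < \<epsilon>) sequentially"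
    using assms by (intro order_tendstoD(2)) auto
  then obtain q where q: "(1 - c) ^ q * d < \<epsilon>" by (auto simp: eventually_sequentially)
  show ?thesis
  proof (intro exI[of _ "n * q"] allI impI ballI)
    fix k x y assume k: "n * q \<le> k" and x: "x \<in> S" and y: "y \<in> S"
    let ?h = "(T ^^ (n * q)) f"
    have h: "?h u - ?h v \<le> \<epsilon>" if "u \<in> S" "v \<in> S" for u v
      using iter[of u v q] that q by simp
    \<comment> \<open>Later iterates are averages of \<open>?h\<close>, so they inherit its spread.\<close>
    have "(T ^^ r) ?h x - ?h v \<le> \<epsilon>" if "v \<in> S" for r v
      using iterate_le[of "\<lambda>u. ?h u - ?h v" \<epsilon> x r] h x that by (simp add: iterate_diff_const)
    then have "(T ^^ r) ?h x - \<epsilon> \<le> ?h v" if "v \<in> S" for r v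
      using that by (simp add: algebra_simps)
    then have "(T ^^ r) ?h x - \<epsilon> \<le> (T ^^ r) ?h y" for r
      using y by (intro iterate_ge[where f = ?h])
    moreover have "(T ^^ k) f = (T ^^ (k - n * q)) ?h"
      using k by (metis comp_apply funpow_add le_add_diff_inverse2)
    ultimately show "(T ^^ k) f x - (T ^^ k) f y \<le> \<epsilon>" by (simp add: algebra_simps)
  qed
qed

text \<open>
  The iterates keep the mean of \<open>f\<close> over \<open>S\<close> while their spread tends to 0.
\<close>

theorem equidistribution:
  assumes "0 < \<epsilon>"
  shows "\<exists>N. \<forall>k\<ge>N. \<forall>x\<in>S. \<bar>(T ^^ k) f x - (\<Sum>y\<in>S. f y) / card S\<bar> \<le> \<epsilon>"
proof -
  obtain N where N: "\<And>k x y. N \<le> k \<Longrightarrow> x \<in> S \<Longrightarrow> y \<in> S \<Longrightarrow> (T ^^ k) f x - (T ^^ k) f y \<le> \<epsilon>"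
    using spread_tendsto_0[OF assms, of f] by blast
  have card: "0 < card S" using finite_states nonempty by (simp add: card_gt_0_iff)
  show ?thesis
  proof (intro exI[of _ N] allI impI ballI)
    fix k x assume k: "N \<le> k" and x: "x \<in> S"
    let ?h = "(T ^^ k) f"
    have "card S * ?h x - (\<Sum>y\<in>S. f y) = (\<Sum>y\<in>S. ?h x - ?h y)"
      by (simp add: sum_subtractf sum_iterate)
    also have "\<bar>\<dots>\<bar> \<le> (\<Sum>y\<in>S. \<epsilon>)"
      using N[OF k x] N[OF k _ x]
      by (intro order_trans[OF sum_abs] sum_mono abs_leI) auto
    finally have "\<bar>card S * ?h x - (\<Sum>y\<in>S. f y)\<bar> \<le> card S * \<epsilon>" by simp
    moreover have "card S * ?h x - (\<Sum>y\<in>S. f y) = card S * (?h x - (\<Sum>y\<in>S. f y) / card S)"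
      using card by (simp add: field_simps)
    ultimately show "\<bar>?h x - (\<Sum>y\<in>S. f y) / card S\<bar> \<le> \<epsilon>"
      using card by (simp add: abs_mult)
  qed
qed

lemma sum_words_eq_iterate:
  "(\<Sum>w | length w = k. (\<Prod>i\<leftarrow>w. pmf p i) * f (fold g w x)) = (T ^^ k) f x"
proof (induction k arbitrary: x)
  case (Suc k)
  have "bij_betw (\<lambda>(i, w). i # w) (UNIV \<times> {w. length w = k}) {w :: 'i list. length w = Suc k}"
    by (rule bij_betwI[where g = "\<lambda>w. (hd w, tl w)"]) (auto simp: length_Suc_conv)
  then have "(\<Sum>w | length w = Suc k. (\<Prod>i\<leftarrow>w. pmf p i) * f (fold g w x))
    = (\<Sum>(i, w)\<in>UNIV \<times> {w. length w = k}. pmf p i * ((\<Prod>i\<leftarrow>w. pmf p i) * f (fold g w (g i x))))"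
    by (subst sum.reindex_bij_betw[symmetric]) (auto intro!: sum.cong)
  also have "\<dots> = (\<Sum>i\<in>UNIV. pmf p i * (\<Sum>w | length w = k. (\<Prod>i\<leftarrow>w. pmf p i) * f (fold g w (g i x))))"
    by (simp add: sum_distrib_left flip: sum.cartesian_product)
  also have "\<dots> = (T ^^ Suc k) f x" by (simp add: Suc expected_step_def[of p g "(T ^^ k) f"])
  finally show ?case .
qed simp

text \<open>
  The last letter is independent of the position before it.
\<close>

lemma sum_words_last:
  "(\<Sum>w | length w = Suc n \<and> last w = i \<and> fold g w x = y. \<Prod>i\<leftarrow>w. pmf p i)
     = pmf p i * (T ^^ n) (\<lambda>u. of_bool (g i u = y)) x"
proof -
  have "bij_betw (\<lambda>w. w @ [i]) {w. length w = n \<and> g i (fold g w x) = y}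
          {w. length w = Suc n \<and> last w = i \<and> fold g w x = y}"
    by (rule bij_betwI[where g = butlast]) (auto simp: length_Suc_conv_rev)
  then have "(\<Sum>w | length w = Suc n \<and> last w = i \<and> fold g w x = y. \<Prod>i\<leftarrow>w. pmf p i)
    = (\<Sum>w | length w = n \<and> g i (fold g w x) = y. (\<Prod>i\<leftarrow>w. pmf p i) * pmf p i)"
    by (subst sum.reindex_bij_betw[symmetric]) auto
  also have "\<dots> = (\<Sum>w | length w = n. pmf p i * ((\<Prod>i\<leftarrow>w. pmf p i) * of_bool (g i (fold g w x) = y)))"
    using finite_lists_length_eq[of "UNIV :: 'i set" n] by (intro sum.mono_neutral_cong_left) auto
  also have "\<dots> = pmf p i * (T ^^ n) (\<lambda>u. of_bool (g i u = y)) x"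
    using sum_words_eq_iterate[of "\<lambda>u. of_bool (g i u = y)" x n]
    by (simp flip: sum_distrib_left)
  finally show ?thesis .
qed

lemma equidistribution_last:
  assumes "0 < \<epsilon>"
  shows "\<exists>N. \<forall>n\<ge>N. \<forall>x\<in>S. \<forall>y\<in>S. \<forall>i.
    \<bar>(\<Sum>w | length w = Suc n \<and> last w = i \<and> fold g w x = y. \<Prod>i\<leftarrow>w. pmf p i)
      - pmf p i / card S\<bar> \<le> \<epsilon>"
proof -
  let ?f = "\<lambda>i y u. of_bool (g i u = y) :: real"
  have sum_f: "(\<Sum>u\<in>S. ?f i y u) = 1" if "y \<in> S" for i y
  proof -
    have "(\<Sum>u\<in>S. ?f i y u) = (\<Sum>u\<in>S. of_bool (u = y))"
      using sum.reindex_bij_betw[OF bij, of "\<lambda>u. of_bool (u = y) :: real"] by simp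
    also have "\<dots> = 1" using that finite_states by (simp add: of_bool_def)
    finally show ?thesis .
  qed
  have "\<forall>q\<in>UNIV \<times> S. eventually (\<lambda>n. \<forall>x\<in>S.
      \<bar>(T ^^ n) (?f (fst q) (snd q)) x - 1 / card S\<bar> \<le> \<epsilon>) sequentially"
  proof
    fix q :: "'i \<times> 's" assume "q \<in> UNIV \<times> S"
    then have "snd q \<in> S" by auto
    then show "eventually (\<lambda>n. \<forall>x\<in>S.
      \<bar>(T ^^ n) (?f (fst q) (snd q)) x - 1 / card S\<bar> \<le> \<epsilon>) sequentially"
      using equidistribution[OF assms, of "?f (fst q) (snd q)"]
      unfolding eventually_sequentially by (simp only: sum_f)
  qed
  then have "eventually (\<lambda>n. \<forall>q\<in>UNIV \<times> S. \<forall>x\<in>S.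
      \<bar>(T ^^ n) (?f (fst q) (snd q)) x - 1 / card S\<bar> \<le> \<epsilon>) sequentially"
    using finite_states by (intro eventually_ball_finite) auto
  then obtain N where N: "\<And>n i y x. N \<le> n \<Longrightarrow> y \<in> S \<Longrightarrow> x \<in> S \<Longrightarrow>
      \<bar>(T ^^ n) (?f i y) x - 1 / card S\<bar> \<le> \<epsilon>"
    unfolding eventually_sequentially by fastforce
  show ?thesis
  proof (intro exI[of _ N] allI impI ballI)
    fix n x y i assume n: "N \<le> n" and x: "x \<in> S" and y: "y \<in> S"
    have "\<bar>pmf p i * ((T ^^ n) (?f i y) x - 1 / card S)\<bar> \<le> 1 * \<epsilon>"
      unfolding abs_mult using N[OF n y x, of i] by (intro mult_mono) (auto simp: pmf_le_1)
    then show "\<bar>(\<Sum>w | length w = Suc n \<and> last w = i \<and> fold g w x = y. \<Prod>i\<leftarrow>w. pmf p i)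
      - pmf p i / card S\<bar> \<le> \<epsilon>"
      by (simp add: sum_words_last right_diff_distrib)
  qed
qed

end

section \<open>The law of the first letters of the driving sequence\<close>

lemma (in prob_space) prob_iid_word:
  fixes \<alpha> :: "'v::finite pmf" and X :: "nat \<Rightarrow> 'a \<Rightarrow> 'v"
  assumes indep: "indep_vars (\<lambda>_. count_space UNIV) X {1..}"
    and law: "\<And>k. k \<ge> 1 \<Longrightarrow> distr M (count_space UNIV) (X k) = measure_pmf \<alpha>"
  shows "{\<omega> \<in> space M. Q (map (\<lambda>j. X (Suc j) \<omega>) [0..<k])} \<in> events" (is "?set Q \<in> _")
    and "prob {\<omega> \<in> space M. Q (map (\<lambda>j. X (Suc j) \<omega>) [0..<k])}
         = (\<Sum>w | length w = k \<and> Q w. \<Prod>i\<leftarrow>w. pmf \<alpha> i)"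
proof -
  let ?word = "\<lambda>\<omega>. map (\<lambda>j. X (Suc j) \<omega>) [0..<k]"
  have rv: "X j \<in> measurable M (count_space UNIV)" if "j \<ge> 1" for j
    using indep that by (auto simp: indep_vars_def)
  have atom: "?set (\<lambda>w. w = u) \<in> events \<and> prob (?set (\<lambda>w. w = u)) = (\<Prod>i\<leftarrow>u. pmf \<alpha> i)"
    if "length u = k" for u
  proof (cases "k = 0")
    case True
    then show ?thesis using that by (simp add: prob_space)
  next
    case False
    have eq: "?set (\<lambda>w. w = u) = (\<Inter>j\<in>{1..k}. X j -` {u ! (j - 1)} \<inter> space M)"
    proof -
      have "?word \<omega> = u \<longleftrightarrow> (\<forall>j<k. X (Suc j) \<omega> = u ! j)" for \<omega>
        using that by (auto simp: list_eq_iff_nth_eq)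
      also have "\<dots> \<omega> \<longleftrightarrow> (\<forall>j\<in>{1..k}. X j \<omega> = u ! (j - 1))" for \<omega>
        by (auto simp: Suc_le_eq gr0_conv_Suc dest: spec[of _ "_ - 1"])
      finally show ?thesis using False by auto
    qed
    have "prob (\<Inter>j\<in>{1..k}. X j -` {u ! (j - 1)} \<inter> space M)
        = (\<Prod>j\<in>{1..k}. prob (X j -` {u ! (j - 1)} \<inter> space M))"
      using False by (intro indep_varsD[OF indep]) auto
    also have "\<dots> = (\<Prod>j\<in>{1..k}. pmf \<alpha> (u ! (j - 1)))"
    proof (intro prod.cong refl)
      fix j assume j: "j \<in> {1..k}"
      have "pmf \<alpha> (u ! (j - 1)) = measure (distr M (count_space UNIV) (X j)) {u ! (j - 1)}"
        using law[of j] j by (simp add: pmf.rep_eq)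
      then show "prob (X j -` {u ! (j - 1)} \<inter> space M) = pmf \<alpha> (u ! (j - 1))"
        using rv[of j] j by (simp add: measure_distr)
    qed
    also have "\<dots> = (\<Prod>j<k. pmf \<alpha> (u ! j))"
      by (rule prod.reindex_bij_witness[where i = Suc and j = "\<lambda>j. j - 1"]) auto
    also have "\<dots> = (\<Prod>i\<leftarrow>u. pmf \<alpha> i)"
      using that by (simp add: prod.list_conv_set_nth atLeast0LessThan)
    finally show ?thesis
      using eq rv False by (auto intro!: sets.finite_INT measurable_sets)
  qed
  let ?W = "{w. length w = k \<and> Q w}"
  have fin: "finite ?W"
    using finite_lists_length_eq[of "UNIV :: 'v set" k] by (rule rev_finite_subset) auto
  have eq: "?set Q = (\<Union>u\<in>?W. ?set (\<lambda>w. w = u))" by auto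
  show "?set Q \<in> events" unfolding eq using fin atom by (intro sets.finite_UN) auto
  have "prob (\<Union>u\<in>?W. ?set (\<lambda>w. w = u)) = (\<Sum>u\<in>?W. prob (?set (\<lambda>w. w = u)))"
    using fin atom by (intro finite_measure_finite_Union) (auto simp: disjoint_family_on_def)
  also have "\<dots> = (\<Sum>w\<in>?W. \<Prod>i\<leftarrow>w. pmf \<alpha> i)"
    using atom by (intro sum.cong) auto
  finally show "prob (?set Q) = (\<Sum>w\<in>?W. \<Prod>i\<leftarrow>w. pmf \<alpha> i)" by (simp only: eq)
qed

section \<open>The burst at the threshold time\<close>

context eulerian_sandpile
begin

text \<open>
  The coefficient of \<open>\<delta>\<^sub>z\<close> in the decomposition of the state of the chain at time \<open>k\<close>.
\<close>

definition excess :: "'v \<Rightarrow> (nat \<Rightarrow> 'v) \<Rightarrow> 'v sandpile \<Rightarrow> nat \<Rightarrow> int" where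
  "excess z x s0 k =
     chips (closed_chain G x s0 k) - chips (rec_rep G z (closed_chain G x s0 k))"

lemma stabilizable_closed_chain_iff:
  "stabilizable G {} (closed_chain G x s0 k) \<longleftrightarrow> excess z x s0 k < 0"
  by (simp add: stabilizable_iff[of _ z] excess_def)

lemma excess_eq:
  "excess z x s0 k = chips s0 + int k - chips (rec_rep G z (closed_chain G x s0 k))"
  by (simp add: excess_def chips_closed_chain)

lemma excess_Suc:
  "excess z x s0 (Suc k) =
     excess z x s0 k + burst G z (x (Suc k)) (rec_rep G z (closed_chain G x s0 (Suc k)))"
  by (simp add: excess_eq rec_rep_closed_add burst_open_add rec_rep_Rec)

lemma burst_open_add_nonneg: "\<rho> \<in> Rec G z \<Longrightarrow> 0 \<le> burst G z i (open_add G z i \<rho>)"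
  using chips_open_add_le[of \<rho> z i] by (simp add: burst_open_add)

lemma excess_mono: "j \<le> k \<Longrightarrow> excess z x s0 j \<le> excess z x s0 k"
  by (rule lift_Suc_mono_le[of "excess z x s0"])
    (simp_all add: excess_Suc rec_rep_closed_add burst_open_add_nonneg rec_rep_Rec)

lemma INF_enat_eq_iff: "(INF k\<in>A. enat k) = enat n \<longleftrightarrow> n \<in> A \<and> (\<forall>k\<in>A. n \<le> k)"
proof (cases "A = {}")
  case True
  then show ?thesis by (simp add: top_enat_def)
next
  case False
  let ?m = "LEAST k. k \<in> A"
  have m: "?m \<in> A" "\<And>k. k \<in> A \<Longrightarrow> ?m \<le> k"
    using False by (auto intro: LeastI Least_le)
  then have "(INF k\<in>A. enat k) = enat ?m"
    by (intro antisym INF_lower INF_greatest) auto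
  then show ?thesis using m by (auto intro: antisym)
qed

lemma threshold_time_eq_Suc_iff:
  "threshold_time G x s0 = enat (Suc n) \<longleftrightarrow> excess z x s0 n < 0 \<and> 0 \<le> excess z x s0 (Suc n)"
proof -
  have "threshold_time G x s0 = enat (Suc n) \<longleftrightarrow>
      0 \<le> excess z x s0 (Suc n) \<and> (\<forall>k. 0 \<le> excess z x s0 k \<longrightarrow> Suc n \<le> k)"
    by (simp add: threshold_time_def INF_enat_eq_iff stabilizable_closed_chain_iff[of _ _ _ z] not_less)
  also have "(\<forall>k. 0 \<le> excess z x s0 k \<longrightarrow> Suc n \<le> k) \<longleftrightarrow> excess z x s0 n < 0"
    using excess_mono[of _ n z x s0] by (meson Suc_n_not_le_n not_less not_less_eq_eq order_trans)
  finally show ?thesis by blast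
qed

text \<open>
  The ways \<open>(i, \<eta>, j)\<close> in which a burst of size \<open>b\<close> can carry the excess from negative to
  nonnegative: the letter used, the recurrent representative reached, and the excess reached.
\<close>

definition crossings :: "'v \<Rightarrow> nat \<Rightarrow> ('v \<times> 'v sandpile \<times> nat) set" where
  "crossings z b = {(i, \<eta>, j). \<eta> \<in> Rec G z \<and> burst G z i \<eta> = int b \<and> j < b}"

lemma finite_crossings: "finite (crossings z b)"
proof (rule finite_subset)
  show "crossings z b \<subseteq> UNIV \<times> Rec G z \<times> {..<b}" by (auto simp: crossings_def)
qed (simp add: finite_Rec)

text \<open>
  The number of steps before the crossing step. Since the excess at time \<open>k\<close> is
  \<open>|s\<^sub>0| + k - |\<eta>|\<close>, the crossing step itself is number \<open>|\<eta>| - |s\<^sub>0| + j\<close>, which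
  is at least 1 when \<open>|s\<^sub>0| < 0\<close>.
\<close>

definition crossing_time :: "'v sandpile \<Rightarrow> 'v sandpile \<times> nat \<Rightarrow> nat" where
  "crossing_time s0 = (\<lambda>(\<eta>, j). nat (chips \<eta> - chips s0 + int j - 1))"

definition takes_crossing ::
    "'v \<Rightarrow> (nat \<Rightarrow> 'v) \<Rightarrow> 'v sandpile \<Rightarrow> 'v \<times> 'v sandpile \<times> nat \<Rightarrow> bool" where
  "takes_crossing z x s0 = (\<lambda>(i, \<eta>, j). let k = Suc (crossing_time s0 (\<eta>, j)) in
     x k = i \<and> rec_rep G z (closed_chain G x s0 k) = \<eta>)"

lemma chips_Rec_nonneg: "\<rho> \<in> Rec G z \<Longrightarrow> 0 \<le> chips \<rho>"
  unfolding chips_def by (intro sum_nonneg Rec_nonneg)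

text \<open>
  Being in state \<open>\<eta>\<close> at the prescribed time is the same as having excess \<open>j\<close>. The excess one
  step earlier is then \<open>j - b < 0\<close>, so the crossing takes place at the threshold time.
\<close>

lemma takes_crossing_iff:
  assumes "chips s0 < 0" and "(i, \<eta>, j) \<in> crossings z b"
  shows "takes_crossing z x s0 (i, \<eta>, j) \<longleftrightarrow>
    (\<exists>n. threshold_time G x s0 = enat (Suc n) \<and> excess z x s0 (Suc n) = int j \<and>
      x (Suc n) = i \<and> rec_rep G z (closed_chain G x s0 (Suc n)) = \<eta>)"
proof -
  let ?n = "crossing_time s0 (\<eta>, j)"
  have \<eta>: "0 \<le> chips \<eta>" "burst G z i \<eta> = int b" "j < b"
    using assms(2) chips_Rec_nonneg by (auto simp: crossings_def)
  have n: "n = ?n \<longleftrightarrow> chips s0 + int (Suc n) - chips \<eta> = int j" for n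
    using \<eta>(1) assms(1) by (auto simp: crossing_time_def)
  have "takes_crossing z x s0 (i, \<eta>, j) \<longleftrightarrow>
     (\<exists>n. n = ?n \<and> x (Suc n) = i \<and> rec_rep G z (closed_chain G x s0 (Suc n)) = \<eta>)"
    by (simp only: takes_crossing_def Let_def prod.case simp_thms)
  also have "\<dots> \<longleftrightarrow> (\<exists>n. threshold_time G x s0 = enat (Suc n) \<and> excess z x s0 (Suc n) = int j \<and>
      x (Suc n) = i \<and> rec_rep G z (closed_chain G x s0 (Suc n)) = \<eta>)"
  proof (intro iff_exI iffI)
    fix n
    assume *: "n = ?n \<and> x (Suc n) = i \<and> rec_rep G z (closed_chain G x s0 (Suc n)) = \<eta>"
    then have e: "excess z x s0 (Suc n) = int j" using n[of n] by (simp only: excess_eq)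
    moreover have "x (Suc n) = i" "rec_rep G z (closed_chain G x s0 (Suc n)) = \<eta>"
      using * by blast+
    then have "burst G z (x (Suc n)) (rec_rep G z (closed_chain G x s0 (Suc n))) = int b"
      using \<eta>(2) by (simp only:)
    then have "excess z x s0 n = int j - int b"
      using e excess_Suc[of z x s0 n] by linarith
    ultimately have "threshold_time G x s0 = enat (Suc n)"
      using \<eta>(3) unfolding threshold_time_eq_Suc_iff[of _ _ _ z] by linarith
    then show "threshold_time G x s0 = enat (Suc n) \<and> excess z x s0 (Suc n) = int j \<and>
      x (Suc n) = i \<and> rec_rep G z (closed_chain G x s0 (Suc n)) = \<eta>"
      using * e by blast
  next
    fix n
    assume *: "threshold_time G x s0 = enat (Suc n) \<and> excess z x s0 (Suc n) = int j \<and>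
      x (Suc n) = i \<and> rec_rep G z (closed_chain G x s0 (Suc n)) = \<eta>"
    then have "chips s0 + int (Suc n) - chips \<eta> = int j" using excess_eq[of z x s0 "Suc n"] by metis
    then show "n = ?n \<and> x (Suc n) = i \<and> rec_rep G z (closed_chain G x s0 (Suc n)) = \<eta>"
      using n[of n] * by blast
  qed
  finally show ?thesis .
qed

lemma takes_crossing_unique:
  assumes "chips s0 < 0" and "c \<in> crossings z b" "c' \<in> crossings z b"
    and "takes_crossing z x s0 c" "takes_crossing z x s0 c'"
  shows "c = c'"
proof -
  obtain i \<eta> j i' \<eta>' j' where c: "c = (i, \<eta>, j)" "c' = (i', \<eta>', j')" by (metis prod_cases3)
  show ?thesis
    using assms(2-5) unfolding c
    by (auto simp: takes_crossing_iff[OF assms(1)] simp del: closed_chain.simps)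
qed

lemma threshold_burst_iff_crossing:
  assumes "chips s0 < 0"
  shows "(\<exists>k\<ge>1. threshold_time G x s0 = enat k \<and>
           burst G z (x k) (rec_rep G z (closed_chain G x s0 k)) = int b)
    \<longleftrightarrow> (\<exists>c\<in>crossings z b. takes_crossing z x s0 c)"
proof
  assume "\<exists>k\<ge>1. threshold_time G x s0 = enat k \<and>
           burst G z (x k) (rec_rep G z (closed_chain G x s0 k)) = int b"
  then obtain n where n: "threshold_time G x s0 = enat (Suc n)"
    "burst G z (x (Suc n)) (rec_rep G z (closed_chain G x s0 (Suc n))) = int b"
    by (metis One_nat_def Suc_le_D)
  let ?\<eta> = "rec_rep G z (closed_chain G x s0 (Suc n))" and ?j = "nat (excess z x s0 (Suc n))"
  have "0 \<le> excess z x s0 (Suc n)" "excess z x s0 (Suc n) < int b"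
    using n threshold_time_eq_Suc_iff[of x s0 n z] excess_Suc[of z x s0 n] by auto
  then have j: "int ?j = excess z x s0 (Suc n)" "?j < b" by auto
  from j(2) have c: "(x (Suc n), ?\<eta>, ?j) \<in> crossings z b"
    using n(2) by (simp only: crossings_def mem_Collect_eq prod.case rec_rep_Rec)
  moreover have "takes_crossing z x s0 (x (Suc n), ?\<eta>, ?j)"
    using n(1) j(1) unfolding takes_crossing_iff[OF assms c] by (intro exI[of _ n]) (simp only:)
  ultimately show "\<exists>c\<in>crossings z b. takes_crossing z x s0 c" by blast
next
  assume "\<exists>c\<in>crossings z b. takes_crossing z x s0 c"
  then obtain i \<eta> j where c: "(i, \<eta>, j) \<in> crossings z b" "takes_crossing z x s0 (i, \<eta>, j)"
    by (metis prod_cases3)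
  then obtain n where "threshold_time G x s0 = enat (Suc n)" "x (Suc n) = i"
      "rec_rep G z (closed_chain G x s0 (Suc n)) = \<eta>"
    using takes_crossing_iff[OF assms c(1)] by blast
  moreover have "burst G z i \<eta> = int b" using c(1) by (simp add: crossings_def)
  ultimately show "\<exists>k\<ge>1. threshold_time G x s0 = enat k \<and>
           burst G z (x k) (rec_rep G z (closed_chain G x s0 k)) = int b"
    by (intro exI[of _ "Suc n"]) simp
qed

lemma takes_crossing_word:
  "takes_crossing z x s0 (i, \<eta>, j) \<longleftrightarrow>
    (let w = map (\<lambda>j. x (Suc j)) [0..<Suc (crossing_time s0 (\<eta>, j))] in
      last w = i \<and> fold (open_add G z) w (rec_rep G z s0) = \<eta>)"
  by (simp add: takes_crossing_def Let_def rec_rep_closed_chain del: closed_chain.simps)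

text \<open>
  The free coordinate \<open>j\<close> contributes the factor \<open>b\<close>.
\<close>

lemma sum_crossings:
  "(\<Sum>(i, \<eta>, j)\<in>crossings z b. pmf \<alpha> i / card (Rec G z)) = real b * burst_prob G \<alpha> z b"
proof -
  let ?B = "\<lambda>i \<eta>. if burst G z i \<eta> = int b then 1 else (0::real)"
  have "(\<Sum>(i, \<eta>, j)\<in>crossings z b. pmf \<alpha> i / card (Rec G z)) =
    (\<Sum>(i, \<eta>, j)\<in>UNIV \<times> Rec G z \<times> {..<b}. pmf \<alpha> i / card (Rec G z) * ?B i \<eta>)"
    by (rule sum.mono_neutral_cong_left) (auto simp: crossings_def finite_Rec)
  also have "\<dots> = (\<Sum>i\<in>UNIV. \<Sum>\<eta>\<in>Rec G z. \<Sum>j<b. pmf \<alpha> i / card (Rec G z) * ?B i \<eta>)"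
    by (simp only: sum.cartesian_product)
  also have "\<dots> = real b * burst_prob G \<alpha> z b"
    by (simp add: burst_prob_def sum_distrib_left)
  finally show ?thesis .
qed

lemma permutation_walk_open_add:
  assumes "\<And>i. 0 < pmf \<alpha> i"
  shows "permutation_walk \<alpha> (open_add G z) (Rec G z) z"
proof
  show "Rec G z \<noteq> {}" using rec_rep_Rec by blast
qed (use assms finite_Rec bij_betw_open_add open_add_sink open_add_irreducible in auto)

end

theorem corollary7:
  fixes G :: "('v::finite, 'e) pre_digraph"
    and \<alpha> :: "'v pmf"
    and z :: 'v
    and M :: "'w measure"
    and X :: "nat \<Rightarrow> 'w \<Rightarrow> 'v"
    and b :: nat
  assumes "eulerian_digraph G"
    and "\<And>i. pmf \<alpha> i > 0"
    and "prob_space M"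
    and "prob_space.indep_vars M (\<lambda>_. count_space UNIV) X {1..}"
    and "\<And>k. k \<ge> 1 \<Longrightarrow> distr M (count_space UNIV) (X k) = measure_pmf \<alpha>"
  shows "\<forall>\<epsilon>>0. \<exists>K<0. \<forall>s0 :: 'v sandpile. chips s0 < K \<longrightarrow>
           \<bar>threshold_burst_prob G z M X b s0 - real b * burst_prob G \<alpha> z b\<bar> \<le> \<epsilon>"
proof (intro allI impI)
  fix \<epsilon> :: real assume "0 < \<epsilon>"
  interpret eulerian_sandpile G using assms(1) by unfold_locales
  interpret prob_space M by (rule assms(3))
  interpret permutation_walk \<alpha> "open_add G z" "Rec G z" z
    using assms(2) by (rule permutation_walk_open_add)
  let ?C = "crossings z b" and ?\<kappa> = "card (Rec G z)"
  \<comment> \<open>The error is spread over the crossings; adding 1 covers the case without crossings.\<close>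
  define \<epsilon>' where "\<epsilon>' = \<epsilon> / (card ?C + 1)"
  have "0 < \<epsilon>'" using \<open>0 < \<epsilon>\<close> by (simp add: \<epsilon>'_def)
  define q where "q n \<rho> i \<eta> = (\<Sum>w | length w = Suc n \<and> last w = i \<and>
      fold (open_add G z) w \<rho> = \<eta>. \<Prod>i\<leftarrow>w. pmf \<alpha> i)" for n \<rho> i \<eta>
  obtain N where N: "\<And>n \<rho> \<eta> i. N \<le> n \<Longrightarrow> \<rho> \<in> Rec G z \<Longrightarrow> \<eta> \<in> Rec G z \<Longrightarrow>
      \<bar>q n \<rho> i \<eta> - pmf \<alpha> i / ?\<kappa>\<bar> \<le> \<epsilon>'"
    using equidistribution_last[OF \<open>0 < \<epsilon>'\<close>] unfolding q_def by blast
  show "\<exists>K<0. \<forall>s0. chips s0 < K \<longrightarrow>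
      \<bar>threshold_burst_prob G z M X b s0 - real b * burst_prob G \<alpha> z b\<bar> \<le> \<epsilon>"
  proof (intro exI[of _ "- int N - 1"] conjI allI impI)
    fix s0 :: "'v sandpile" assume s0: "chips s0 < - int N - 1"
    then have neg: "chips s0 < 0" by simp
    let ?\<rho> = "rec_rep G z s0"
    let ?E = "\<lambda>c. {\<omega> \<in> space M. takes_crossing z (\<lambda>n. X n \<omega>) s0 c}"
    let ?q = "\<lambda>(i, \<eta>, j). q (crossing_time s0 (\<eta>, j)) ?\<rho> i \<eta>"
    have E: "?E c \<in> events" "prob (?E c) = ?q c" if "c \<in> ?C" for c
    proof -
      obtain i \<eta> j where c: "c = (i, \<eta>, j)" by (metis prod_cases3)
      have *: "?E c = {\<omega> \<in> space M. last (map (\<lambda>j. X (Suc j) \<omega>) [0..<Suc (crossing_time s0 (\<eta>, j))]) = i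
         \<and> fold (open_add G z) (map (\<lambda>j. X (Suc j) \<omega>) [0..<Suc (crossing_time s0 (\<eta>, j))]) ?\<rho> = \<eta>}"
        by (simp only: c takes_crossing_word Let_def)
      note word = prob_iid_word[OF assms(4,5), where k = "Suc (crossing_time s0 (\<eta>, j))"
          and Q = "\<lambda>w. last w = i \<and> fold (open_add G z) w ?\<rho> = \<eta>"]
      show "?E c \<in> events" unfolding * by (rule word(1))
      show "prob (?E c) = ?q c" unfolding * by (simp only: word(2) c prod.case q_def)
    qed
    have "threshold_burst_prob G z M X b s0 = prob (\<Union>c\<in>?C. ?E c)"
      unfolding threshold_burst_prob_def threshold_burst_iff_crossing[OF neg]
      by (intro arg_cong[of _ _ prob]) auto
    also have "\<dots> = (\<Sum>c\<in>?C. prob (?E c))"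
      using E(1) takes_crossing_unique[OF neg] finite_crossings
      by (intro finite_measure_finite_Union) (auto simp: disjoint_family_on_def)
    also have "\<dots> = (\<Sum>c\<in>?C. ?q c)"
      by (intro sum.cong refl E(2))
    finally have "\<bar>threshold_burst_prob G z M X b s0 - real b * burst_prob G \<alpha> z b\<bar>
        = \<bar>\<Sum>c\<in>?C. ?q c - (case c of (i, \<eta>, j) \<Rightarrow> pmf \<alpha> i / ?\<kappa>)\<bar>"
      by (simp only: sum_subtractf sum_crossings)
    also have "\<dots> \<le> (\<Sum>c\<in>?C. \<bar>?q c - (case c of (i, \<eta>, j) \<Rightarrow> pmf \<alpha> i / ?\<kappa>)\<bar>)"
      by (rule sum_abs)
    also have "\<dots> \<le> (\<Sum>c\<in>?C. \<epsilon>')"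
    proof (rule sum_mono)
      fix c assume "c \<in> ?C"
      moreover obtain i \<eta> j where c: "c = (i, \<eta>, j)" by (metis prod_cases3)
      ultimately have \<eta>: "\<eta> \<in> Rec G z" by (simp add: crossings_def)
      then have "N \<le> crossing_time s0 (\<eta>, j)"
        using s0 chips_Rec_nonneg[OF \<eta>] by (simp add: crossing_time_def)
      then show "\<bar>?q c - (case c of (i, \<eta>, j) \<Rightarrow> pmf \<alpha> i / ?\<kappa>)\<bar> \<le> \<epsilon>'"
        using N rec_rep_Rec \<eta> by (simp add: c)
    qed
    also have "\<dots> \<le> \<epsilon>" using \<open>0 < \<epsilon>\<close> by (simp add: \<epsilon>'_def field_simps)
    finally show "\<bar>threshold_burst_prob G z M X b s0 - real b * burst_prob G \<alpha> z b\<bar> \<le> \<epsilon>" .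
  qed simp
qed

end
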